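(* Let $K$ be an infinite field of characteristic $p$ with $p=0$ or $p>3$, let $d\ge1$, and let $\Delta=(\delta_1,\ldots,\delta_d)$ be a multidegree with $\delta_1\ge\cdots\ge\delta_d\ge1$. Then (the image in $N_{3,d}$ of) the set $B_\Delta$ is a basis of the $K$-vector space $N_{3,d}(\Delta)$, where $B_\Delta$ is defined as follows (we write $i$ for $x_i$ in items 2)–4), so e.g. $231^24=x_2x_3x_1^2x_4$): 1) if $d\le 3$: - $B_1=\{x_1\}$, $B_{1^2}=\{x_1x_2,\ x_2x_1\}$, $B_2=\{x_1^2\}$, $B_{1^3}=\{x_1x_2x_3,\ x_1x_3x_2,\ x_2x_1x_3,\ x_2x_3x_1,\ x_3x_1x_2\}$, $B_{21}=\{x_1^2x_2,\ x_2x_1^2\}$; - $B_{21^2}=\{x_1^2x_2x_3,\ x_1^2x_3x_2,\ x_2x_1^2x_3,\ x_2x_3x_1^2,\ x_3x_2x_1^2\}$, $B_{2^2}=\{x_1^2x_2^2,\ x_2^2x_1^2\}$, $B_{31}=\{x_1^2x_2x_1\}$; - $B_{2^21}=\{x_1^2x_2^2x_3,\ x_2^2x_1^2x_3,\ x_3x_1^2x_2^2\}$, $B_{31^2}=\{x_1^2x_2x_3x_1,\ x_1^2x_3x_2x_1\}$, $B_{32}=\{x_1^2x_2^2x_1\}$; - $B_\Delta=\emptyset$ for all other $\Delta$ with $d\le3$; 2) $B_{1^4}=\{1234, 1243, 1324, 1342, 1423, 2134, 2143, 2314, 2341, 2413, 3124, 3412\}$; 3) $B_{1^5}=\{12345,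 12354, 12435, 12453, 12534, 13245, 13254, 13425, 13452, 13524, 14235, 14523, 23145, 23415, 23514\}$; 4) $B_{21^3}=\{1^2234,\ 1^2324,\ 1^2423,\ 21^234,\ 21^243,\ 231^24,\ 241^23\}$; 5) if $\delta_1+\cdots+\delta_d\ge6$, then $B_\Delta=\emptyset$.
   Context: $N_{3,d}$ is the quotient of the free associative non-unitary $K$-algebra $K\langle x_1,\ldots,x_d\rangle^{\#}$ by the ideal generated by all $a^3$, $a\in K\langle x_1,\ldots,x_d\rangle^{\#}$. It is $\mathbb N^d$-graded by multidegree, where $\mathbb N=\{0,1,2,\dots\}$, and $N_{3,d}(\Delta)$ is its homogeneous component of multidegree $\Delta$. The notation $3^r2^s1^t$ denotes the multidegree $(3,\ldots,3,2,\ldots,2,1,\ldots,1)$ with $r$ threes, $s$ twos and $t$ ones; e.g. $21^3=(2,1,1,1)$. Words are identified with their images in $N_{3,d}$. *)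

theory Defs
  imports
    "HOL-Library.Poly_Mapping"
    "HOL-Algebra.QuotRing"
    "Jordan_Normal_Form.VS_Connect"
begin

text \<open>
  The word $x_{i_1} \cdots x_{i_n}$ is the list $[i_1, \ldots, i_n]$.  Words form a monoid under
  concatenation, so the type \<open>nat list \<Rightarrow>\<^sub>0 'k\<close> with its convolution product is the unital free
  associative algebra on countably many letters $x_0, x_1, x_2, \ldots$
\<close>

instantiation list :: (type) monoid_add
begin

definition zero_list_def: "0 = ([] :: 'a list)"

definition plus_list_def: "(u :: 'a list) + v = u @ v"

instance
  by standard (simp_all add: zero_list_def plus_list_def)

end

text \<open>
  The free non-unitary algebra on $x_1, \ldots, x_d$: the elements without constant term in which
  only these letters occur.  It has no unit; the \<^const>\<open>one\<close> field of the record is a junk value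
  outside the carrier.
\<close>

definition free_alg :: "nat \<Rightarrow> ('k::field, nat list \<Rightarrow>\<^sub>0 'k) module" where
  "free_alg d =
    \<lparr>carrier = {f. \<forall>w\<in>Poly_Mapping.keys f. w \<noteq> [] \<and> set w \<subseteq> {1..d}},
     mult = (*), one = 1, zero = 0, add = (+),
     smult = (\<lambda>c. Poly_Mapping.map ((*) c))\<rparr>"

definition alg_ideal :: "'a set \<Rightarrow> ('k::field, 'a) module \<Rightarrow> bool" where
  "alg_ideal I A \<longleftrightarrow> Module.submodule I class_ring A \<and>
     (\<forall>a\<in>carrier A. \<forall>x\<in>I. a \<otimes>\<^bsub>A\<^esub> x \<in> I \<and> x \<otimes>\<^bsub>A\<^esub> a \<in> I)"

definition gen_alg_ideal :: "('k::field, 'a) module \<Rightarrow> 'a set \<Rightarrow> 'a set" where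
  "gen_alg_ideal A S = \<Inter>{I. alg_ideal I A \<and> S \<subseteq> I}"

definition quot_alg :: "('k::field, 'a) module \<Rightarrow> 'a set \<Rightarrow> ('k, 'a set) module" where
  "quot_alg A I =
    \<lparr>carrier = a_rcosets\<^bsub>A\<^esub> I, mult = rcoset_mult A I,
     one = I +>\<^bsub>A\<^esub> \<one>\<^bsub>A\<^esub>, zero = I, add = set_add A,
     smult = (\<lambda>c X. \<Union>f\<in>X. I +>\<^bsub>A\<^esub> (c \<odot>\<^bsub>A\<^esub> f))\<rparr>"

definition cube_ideal :: "nat \<Rightarrow> (nat list \<Rightarrow>\<^sub>0 'k::field) set" where
  "cube_ideal d = gen_alg_ideal (free_alg d) {a ^ 3 | a. a \<in> carrier (free_alg d)}"

definition nil3_alg :: "nat \<Rightarrow> ('k::field, (nat list \<Rightarrow>\<^sub>0 'k) set) module" where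
  "nil3_alg d = quot_alg (free_alg d) (cube_ideal d)"

definition nil3_class :: "nat \<Rightarrow> (nat list \<Rightarrow>\<^sub>0 'k::field) \<Rightarrow> (nat list \<Rightarrow>\<^sub>0 'k) set" where
  "nil3_class d f = cube_ideal d +>\<^bsub>free_alg d\<^esub> f"

text \<open>
  A multidegree is a list \<open>\<Delta>\<close> of length \<open>d\<close>.  Its entry at position \<open>i\<close>, counted from $0$, is the
  degree in $x_{i+1}$.
\<close>

definition homogeneous :: "nat \<Rightarrow> nat list \<Rightarrow> (nat list \<Rightarrow>\<^sub>0 'k::field) set" where
  "homogeneous d \<Delta> =
    {f \<in> carrier (free_alg d). \<forall>w\<in>Poly_Mapping.keys f. \<forall>i<d. count_list w (i + 1) = \<Delta> ! i}"

definition nil3_component :: "nat \<Rightarrow> nat list \<Rightarrow> ('k::field, (nat list \<Rightarrow>\<^sub>0 'k) set) module" where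
  "nil3_component d \<Delta> = (nil3_alg d)\<lparr>carrier := nil3_class d ` homogeneous d \<Delta>\<rparr>"

definition word_class :: "nat \<Rightarrow> nat list \<Rightarrow> (nat list \<Rightarrow>\<^sub>0 'k::field) set" where
  "word_class d w = nil3_class d (Poly_Mapping.single w 1)"

text \<open>
  A nonincreasing multidegree with positive entries that has length at least $4$ and sum at most
  $5$ is one of $1^4$, $1^5$ and $21^3$, so the final \<open>{}\<close> covers exactly the remaining cases of
  length at most $3$ and those of sum at least $6$.
\<close>

definition basis_words :: "nat list \<Rightarrow> nat list set" where
  "basis_words \<Delta> =
    (if \<Delta> = [1] then {[1]}
     else if \<Delta> = [1,1] then {[1,2], [2,1]}
     else if \<Delta> = [2] then {[1,1]}
     else if \<Delta> = [1,1,1] then {[1,2,3], [1,3,2], [2,1,3], [2,3,1], [3,1,2]}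
     else if \<Delta> = [2,1] then {[1,1,2], [2,1,1]}
     else if \<Delta> = [2,1,1] then {[1,1,2,3], [1,1,3,2], [2,1,1,3], [2,3,1,1], [3,2,1,1]}
     else if \<Delta> = [2,2] then {[1,1,2,2], [2,2,1,1]}
     else if \<Delta> = [3,1] then {[1,1,2,1]}
     else if \<Delta> = [2,2,1] then {[1,1,2,2,3], [2,2,1,1,3], [3,1,1,2,2]}
     else if \<Delta> = [3,1,1] then {[1,1,2,3,1], [1,1,3,2,1]}
     else if \<Delta> = [3,2] then {[1,1,2,2,1]}
     else if \<Delta> = [1,1,1,1] then
       {[1,2,3,4], [1,2,4,3], [1,3,2,4], [1,3,4,2], [1,4,2,3], [2,1,3,4],
        [2,1,4,3], [2,3,1,4], [2,3,4,1], [2,4,1,3], [3,1,2,4], [3,4,1,2]}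
     else if \<Delta> = [1,1,1,1,1] then
       {[1,2,3,4,5], [1,2,3,5,4], [1,2,4,3,5], [1,2,4,5,3], [1,2,5,3,4],
        [1,3,2,4,5], [1,3,2,5,4], [1,3,4,2,5], [1,3,4,5,2], [1,3,5,2,4],
        [1,4,2,3,5], [1,4,5,2,3], [2,3,1,4,5], [2,3,4,1,5], [2,3,5,1,4]}
     else if \<Delta> = [2,1,1,1] then
       {[1,1,2,3,4], [1,1,3,2,4], [1,1,4,2,3], [2,1,1,3,4], [2,1,1,4,3],
        [2,3,1,1,4], [2,4,1,1,3]}
     else {})"

lemma free_alg_simps:
  "carrier (free_alg d) = {f. \<forall>w\<in>Poly_Mapping.keys f. w \<noteq> [] \<and> set w \<subseteq> {1..d}}"
  "f \<otimes>\<^bsub>free_alg d\<^esub> g = f * g" "f \<oplus>\<^bsub>free_alg d\<^esub> g = f + g" "\<zero>\<^bsub>free_alg d\<^esub> = 0"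
  "c \<odot>\<^bsub>free_alg d\<^esub> f = Poly_Mapping.map ((*) c) f"
  by (simp_all add: free_alg_def)

context
  notes free_alg_simps [simp]
begin

lemma keys_scale: "w \<in> Poly_Mapping.keys (Poly_Mapping.map ((*) (c::'k::field)) f) \<Longrightarrow> w \<in> Poly_Mapping.keys f"
  by (auto simp: in_keys_iff Poly_Mapping.map.rep_eq when_def)

lemma module_free_alg: "module (class_ring :: 'k::field ring) (free_alg d)"
proof (rule moduleI)
  show "cring (class_ring :: 'k ring)"
    by (rule domain.axioms(1)[OF field.axioms(1)[OF class_field]])
  show "abelian_group (free_alg d :: ('k, _) module)"
  proof (rule abelian_groupI)
    fix x y :: "nat list \<Rightarrow>\<^sub>0 'k"
    show "x \<in> carrier (free_alg d) \<Longrightarrow> y \<in> carrier (free_alg d) \<Longrightarrow> x \<oplus>\<^bsub>free_alg d\<^esub> y \<in> carrier (free_alg d)"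
      using Poly_Mapping.keys_add[of x y] by auto
    show "\<exists>y\<in>carrier (free_alg d). y \<oplus>\<^bsub>free_alg d\<^esub> x = \<zero>\<^bsub>free_alg d\<^esub>" if "x \<in> carrier (free_alg d)"
      using that by (intro bexI[of _ "- x"]) auto
  qed (auto simp: algebra_simps)
  show "a \<odot>\<^bsub>free_alg d\<^esub> x \<in> carrier (free_alg d)" if "x \<in> carrier (free_alg d)" for a :: 'k and x
    using that by (auto dest: keys_scale)
  fix a b :: 'k and x y :: "nat list \<Rightarrow>\<^sub>0 'k"
  show "(a \<oplus>\<^bsub>class_ring\<^esub> b) \<odot>\<^bsub>free_alg d\<^esub> x =
      a \<odot>\<^bsub>free_alg d\<^esub> x \<oplus>\<^bsub>free_alg d\<^esub> b \<odot>\<^bsub>free_alg d\<^esub> x"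
    by (simp add: mult_map_scale_conv_mult single_add distrib_right)
  show "a \<odot>\<^bsub>free_alg d\<^esub> (x \<oplus>\<^bsub>free_alg d\<^esub> y) =
      a \<odot>\<^bsub>free_alg d\<^esub> x \<oplus>\<^bsub>free_alg d\<^esub> a \<odot>\<^bsub>free_alg d\<^esub> y"
    by (simp add: mult_map_scale_conv_mult distrib_left)
  show "(a \<otimes>\<^bsub>class_ring\<^esub> b) \<odot>\<^bsub>free_alg d\<^esub> x =
      a \<odot>\<^bsub>free_alg d\<^esub> (b \<odot>\<^bsub>free_alg d\<^esub> x)"
    using mult_single[of "0 :: nat list" a 0 b]
    by (simp add: mult_map_scale_conv_mult flip: mult.assoc)
  show "\<one>\<^bsub>class_ring\<^esub> \<odot>\<^bsub>free_alg d\<^esub> x = x"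
    by (simp add: mult_map_scale_conv_mult)
qed

lemma submodule_cube_ideal:
  "Module.submodule (cube_ideal d) (class_ring :: 'k::field ring) (free_alg d)"
proof -
  interpret Module.module "class_ring :: 'k ring" "free_alg d" by (rule module_free_alg)
  define \<I> where "\<I> = {I. alg_ideal I (free_alg d :: ('k,_) module) \<and>
    {a ^ 3 | a. a \<in> carrier (free_alg d)} \<subseteq> I}"
  have eq: "cube_ideal d = \<Inter>\<I>" by (simp add: cube_ideal_def gen_alg_ideal_def \<I>_def)
  have sub: "Module.submodule I class_ring (free_alg d :: ('k,_) module)" if "I \<in> \<I>" for I
    using that by (simp add: \<I>_def alg_ideal_def)
  have prod: "a * b \<in> carrier (free_alg d)"
    if "a \<in> carrier (free_alg d)" "b \<in> carrier (free_alg d)" for a b :: "nat list \<Rightarrow>\<^sub>0 'k"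
  proof -
    have "w \<noteq> [] \<and> set w \<subseteq> {1..d}" if w: "w \<in> Poly_Mapping.keys (a * b)" for w
    proof -
      obtain u v where "u \<in> Poly_Mapping.keys a" "v \<in> Poly_Mapping.keys b" "w = u + v"
        using w Poly_Mapping.keys_mult[of a b] by blast
      then show ?thesis using \<open>a \<in> _\<close> \<open>b \<in> _\<close> by (auto simp: plus_list_def)
    qed
    then show ?thesis by simp
  qed
  have "alg_ideal (carrier (free_alg d)) (free_alg d :: ('k,_) module)"
    unfolding alg_ideal_def free_alg_simps(2) using carrier_is_submodule prod by blast
  moreover have "a ^ 3 \<in> carrier (free_alg d)" if "a \<in> carrier (free_alg d)" for a :: "nat list \<Rightarrow>\<^sub>0 'k"
    unfolding power3_eq_cube by (intro prod that)
  ultimately have carr: "carrier (free_alg d) \<in> \<I>"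
    unfolding \<I>_def by blast
  show ?thesis
    unfolding eq
  proof (rule submoduleI)
    show "\<Inter>\<I> \<subseteq> carrier (free_alg d)" using carr by blast
    show "\<zero>\<^bsub>free_alg d\<^esub> \<in> \<Inter>\<I>"
      using submoduleE(2)[OF sub] subgroup.one_closed[OF submodule.axioms(1)[OF sub]] by auto
    show "\<ominus>\<^bsub>free_alg d\<^esub> a \<in> \<Inter>\<I>" if "a \<in> \<Inter>\<I>" for a
      using submoduleE(3)[OF sub] that by blast
    show "a \<oplus>\<^bsub>free_alg d\<^esub> b \<in> \<Inter>\<I>" if "a \<in> \<Inter>\<I>" "b \<in> \<Inter>\<I>" for a b
      using submoduleE(5)[OF sub] that by blast
    show "a \<odot>\<^bsub>free_alg d\<^esub> x \<in> \<Inter>\<I>" if "a \<in> carrier class_ring" "x \<in> \<Inter>\<I>" for a x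
      using submoduleE(4)[OF sub] that by blast
  qed
qed

lemma module_quot_alg:
  fixes A :: "('k::field, 'a) module"
  assumes A: "module class_ring A" and I: "Module.submodule I class_ring A"
  shows "module class_ring (quot_alg A I)"
    and "(\<lambda>f. I +>\<^bsub>A\<^esub> f) \<in> LinearCombinations.module_hom class_ring A (quot_alg A I)"
proof -
  interpret Module.module "class_ring :: 'k ring" A by fact
  interpret I: abelian_subgroup I A
    by (intro abelian_subgroupI3 additive_subgroupI abelian_group_axioms submodule.axioms(1)[OF I])
  have sm: "c \<odot>\<^bsub>quot_alg A I\<^esub> (I +>\<^bsub>A\<^esub> f) = I +>\<^bsub>A\<^esub> (c \<odot>\<^bsub>A\<^esub> f)" if f: "f \<in> carrier A" for c f
  proof -
    have eq: "I +>\<^bsub>A\<^esub> (c \<odot>\<^bsub>A\<^esub> g) = I +>\<^bsub>A\<^esub> (c \<odot>\<^bsub>A\<^esub> f)" if g: "g \<in> I +>\<^bsub>A\<^esub> f" for g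
    proof -
      obtain i where i: "i \<in> I" "g = i \<oplus>\<^bsub>A\<^esub> f"
        using g unfolding a_r_coset_def' by auto
      have "c \<odot>\<^bsub>A\<^esub> g = c \<odot>\<^bsub>A\<^esub> i \<oplus>\<^bsub>A\<^esub> c \<odot>\<^bsub>A\<^esub> f"
        using i f I.a_subset smult_r_distr[of c i f] by auto
      moreover have "c \<odot>\<^bsub>A\<^esub> i \<in> I"
        using submoduleE(4)[OF I, of c i] i by simp
      ultimately have "c \<odot>\<^bsub>A\<^esub> g \<in> I +>\<^bsub>A\<^esub> (c \<odot>\<^bsub>A\<^esub> f)"
        unfolding a_r_coset_def' by auto
      then show ?thesis
        using a_repr_independence[of _ I "c \<odot>\<^bsub>A\<^esub> f"] f I.a_subgroup by simp
    qed
    have "f \<in> I +>\<^bsub>A\<^esub> f" by (rule I.a_rcos_self[OF f])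
    then have "(\<Union>g\<in>I +>\<^bsub>A\<^esub> f. I +>\<^bsub>A\<^esub> (c \<odot>\<^bsub>A\<^esub> g)) = I +>\<^bsub>A\<^esub> (c \<odot>\<^bsub>A\<^esub> f)"
      by (intro SUP_eq_const) (blast, rule eq)
    then show ?thesis by (simp only: quot_alg_def module.select_convs)
  qed
  have ad: "(I +>\<^bsub>A\<^esub> f) \<oplus>\<^bsub>quot_alg A I\<^esub> (I +>\<^bsub>A\<^esub> g) = I +>\<^bsub>A\<^esub> (f \<oplus>\<^bsub>A\<^esub> g)"
    if "f \<in> carrier A" "g \<in> carrier A" for f g
    using I.a_rcos_sum that by (simp add: quot_alg_def)
  have carr: "carrier (quot_alg A I) = (\<lambda>f. I +>\<^bsub>A\<^esub> f) ` carrier A"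
    by (auto simp: quot_alg_def A_RCOSETS_def')
  have sc: "c \<odot>\<^bsub>A\<^esub> f \<in> carrier A" if "f \<in> carrier A" for c f
    using that by simp
  show "(\<lambda>f. I +>\<^bsub>A\<^esub> f) \<in> LinearCombinations.module_hom class_ring A (quot_alg A I)"
    by (auto simp: LinearCombinations.module_hom_def carr sm ad)
  have zero: "\<zero>\<^bsub>quot_alg A I\<^esub> = I +>\<^bsub>A\<^esub> \<zero>\<^bsub>A\<^esub>"
    using a_coset_add_zero[OF I.a_subset] by (simp add: quot_alg_def)
  have "abelian_group (quot_alg A I)"
  proof (rule abelian_groupI)
    show "\<exists>Y\<in>carrier (quot_alg A I). Y \<oplus>\<^bsub>quot_alg A I\<^esub> X = \<zero>\<^bsub>quot_alg A I\<^esub>"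
      if "X \<in> carrier (quot_alg A I)" for X
    proof -
      from that obtain f where "f \<in> carrier A" "X = I +>\<^bsub>A\<^esub> f" unfolding carr by blast
      then show ?thesis
        unfolding carr zero by (intro bexI[of _ "I +>\<^bsub>A\<^esub> (\<ominus>\<^bsub>A\<^esub> f)"]) (simp_all add: ad l_neg)
    qed
  qed (auto simp: carr ad zero a_assoc a_comm a_lcomm)
  moreover have laws: "(a + b) \<odot>\<^bsub>A\<^esub> f = a \<odot>\<^bsub>A\<^esub> f \<oplus>\<^bsub>A\<^esub> b \<odot>\<^bsub>A\<^esub> f"
    "(a * b) \<odot>\<^bsub>A\<^esub> f = a \<odot>\<^bsub>A\<^esub> (b \<odot>\<^bsub>A\<^esub> f)" "1 \<odot>\<^bsub>A\<^esub> f = f"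
    "a \<odot>\<^bsub>A\<^esub> (f \<oplus>\<^bsub>A\<^esub> g) = a \<odot>\<^bsub>A\<^esub> f \<oplus>\<^bsub>A\<^esub> a \<odot>\<^bsub>A\<^esub> g"
    if "f \<in> carrier A" "g \<in> carrier A" for a b f g
    using that smult_l_distr[of a b f] smult_assoc1[of a b f] smult_one[of f] smult_r_distr[of a f g]
    by simp_all
  ultimately show "module class_ring (quot_alg A I)"
    by (intro moduleI Module.module.axioms(1)[OF A])
      (auto simp: carr sm ad sc laws)
qed

text \<open>
  Outside its locale, \<^const>\<open>vectorspace.basis\<close> is defined for arbitrary records; by the next
  lemma the homogeneous components are vector spaces, so there it has its intended meaning.
\<close>

lemma vectorspace_nil3_component:
  "vectorspace (class_ring :: 'k::field ring) (nil3_component d \<Delta>)"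
proof -
  let ?F = "free_alg d :: ('k, _) module" and ?N = "nil3_alg d :: ('k, _) module"
  let ?W = "nil3_class d ` homogeneous d \<Delta> :: (nat list \<Rightarrow>\<^sub>0 'k) set set"
  interpret F: Module.module "class_ring :: 'k ring" ?F by (rule module_free_alg)
  interpret N: Module.module "class_ring :: 'k ring" ?N
    unfolding nil3_alg_def by (rule module_quot_alg[OF module_free_alg submodule_cube_ideal])
  have hom: "nil3_class d \<in> LinearCombinations.module_hom class_ring ?F ?N"
    using module_quot_alg(2)[OF module_free_alg submodule_cube_ideal, of d]
    by (simp add: nil3_class_def[abs_def] nil3_alg_def)
  interpret mod_hom "class_ring :: 'k ring" ?F ?N "nil3_class d"
    by unfold_locales (rule hom)
  have sub: "Module.submodule (homogeneous d \<Delta>) class_ring ?F"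
  proof (rule F.submoduleI)
    fix f g :: "nat list \<Rightarrow>\<^sub>0 'k" and c :: 'k
    show "homogeneous d \<Delta> \<subseteq> carrier ?F" "\<zero>\<^bsub>?F\<^esub> \<in> homogeneous d \<Delta>"
      by (auto simp: homogeneous_def)
    show "f \<oplus>\<^bsub>?F\<^esub> g \<in> homogeneous d \<Delta>" if "f \<in> homogeneous d \<Delta>" "g \<in> homogeneous d \<Delta>"
    proof -
      have "w \<in> Poly_Mapping.keys f \<or> w \<in> Poly_Mapping.keys g" if "w \<in> Poly_Mapping.keys (f + g)" for w
        using that Poly_Mapping.keys_add[of f g] by blast
      then show ?thesis using that by (fastforce simp: homogeneous_def)
    qed
    show smult: "c \<odot>\<^bsub>?F\<^esub> f \<in> homogeneous d \<Delta>" if "f \<in> homogeneous d \<Delta>" for c :: 'k and f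
      using that by (auto simp: homogeneous_def dest: keys_scale)
    show "\<ominus>\<^bsub>?F\<^esub> f \<in> homogeneous d \<Delta>" if f: "f \<in> homogeneous d \<Delta>"
    proof -
      have "(- 1) \<odot>\<^bsub>?F\<^esub> f \<oplus>\<^bsub>?F\<^esub> f = \<zero>\<^bsub>?F\<^esub>"
        by (simp add: poly_mapping_eq_iff fun_eq_iff lookup_add Poly_Mapping.map.rep_eq when_def)
      then have "\<ominus>\<^bsub>?F\<^esub> f = (- 1) \<odot>\<^bsub>?F\<^esub> f"
        using f smult[OF f, of "-1"] by (intro F.minus_equality) (auto simp: homogeneous_def)
      then show ?thesis using smult[OF f] by simp
    qed
  qed
  have "Module.submodule ?W class_ring ?N"
  proof (rule N.submoduleI)
    have H: "f \<in> carrier ?F" if "f \<in> homogeneous d \<Delta>" for f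
      using that by (simp add: homogeneous_def)
    show "?W \<subseteq> carrier ?N"
      using H f_im by blast
    show "\<zero>\<^bsub>?N\<^esub> \<in> ?W"
      using f0_is_0 by (intro image_eqI[of _ _ "0"]) (simp_all add: homogeneous_def)
    fix X assume "X \<in> ?W"
    then obtain f where f: "f \<in> homogeneous d \<Delta>" and X: "X = nil3_class d f" by blast
    show "\<ominus>\<^bsub>?N\<^esub> X \<in> ?W"
      unfolding X f_neg[OF H[OF f], symmetric] by (rule imageI) (rule F.submoduleE(3)[OF sub f])
    show "c \<odot>\<^bsub>?N\<^esub> X \<in> ?W" for c
    proof -
      have "c \<odot>\<^bsub>?N\<^esub> X = nil3_class d (c \<odot>\<^bsub>?F\<^esub> f)"
        unfolding X by (rule f_smult[symmetric]) (simp_all only: partial_object.select_convs UNIV_I H[OF f])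
      then show ?thesis using F.submoduleE(4)[OF sub _ f, of c] by (metis UNIV_I image_eqI partial_object.select_convs(1))
    qed
    show "X \<oplus>\<^bsub>?N\<^esub> Y \<in> ?W" if "Y \<in> ?W" for Y
    proof -
      from that obtain g where g: "g \<in> homogeneous d \<Delta>" and Y: "Y = nil3_class d g" by blast
      show ?thesis
        unfolding X Y f_add[OF H[OF f] H[OF g], symmetric]
        by (rule imageI) (rule F.submoduleE(5)[OF sub f g])
    qed
  qed
  then have "module class_ring (?N\<lparr>carrier := ?W\<rparr>)"
    by (rule Module.submodule.submodule_is_module) (rule N.module_axioms)
  then show ?thesis
    unfolding nil3_component_def vectorspace_def using class_field by blast
qed

end

end

theory Submission
  imports Defs
begin

text \<open>
  Since $2$ and $3$ are invertible, the ideal generated by all cubes is also generated by their full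
  polarizations, the sums \<open>sym3 a b c\<close> of the six products of \<open>a\<close>, \<open>b\<close>, \<open>c\<close>.  Hence it is spanned by
  the elements \<open>u * sym3 a b c * v\<close> for words \<open>a\<close>, \<open>b\<close>, \<open>c\<close> and possibly empty words \<open>u\<close>, \<open>v\<close>, and for
  each multidegree the claim is about a finite system of linear relations between words.

  Degree at least six.  If \<open>s\<close> is a square, then \<open>a * s * b\<close> anticommutes with every \<open>c\<close> modulo the
  ideal (\<open>anticommute\<close>).  An element \<open>X\<close> that anticommutes with \<open>c\<close>, \<open>e\<close> and \<open>c * e\<close> satisfies
  \<open>X * c * e = 0\<close>: passing \<open>c\<close> and \<open>e\<close> one after the other gives the sign $+$, passing them together
  gives $-$.  So a product of six elements vanishes as soon as two neighbours in the middle are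
  equal; together with the relations \<open>sym3\<close> this makes it alternating in all six factors.  But
  the six terms of \<open>sym3 (a*b) (c*d) (e*f)\<close> are even rearrangements of one another, so \<open>6 * (a*b*c*d*e*f) = 0\<close> (\<open>prod_six_in_I\<close>).

  Independence.  Every function \<open>G\<close> of five letters that is symmetric in the first two and cyclic in
  the other three defines a linear form \<open>top_form\<close> on words of length five that vanishes on the ideal.
  Padding shorter words by additional letters turns these forms into forms in lower degree.  For
  each set of basis words some combinations of them have a triangular matrix with entries $\pm 1$,
  $\pm 2$, $\pm 3$ on the diagonal (\<open>triangular_independent\<close>).

  Spanning.  In each degree up to five the remaining words are reached one after the other: a
  combination of relations in which one single word is not yet known to be spanned, with an invertible
  coefficient, shows that this word is spanned, too (\<open>resolve_spanned\<close>).  Besides the generators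
  \<open>u * sym3 a b c * v\<close> two families of relations are used, \<open>anticommute\<close> and \<open>odd_positions\<close>.
  The dual forms and the combinations are listed for the 18 nonincreasing multidegrees of degree
  at most five and checked by rewriting (\<open>certified\<close>).
\<close>

section \<open>Consequences of the identity $x^3 = 0$\<close>

definition sym3 :: "'a::ring_1 \<Rightarrow> 'a \<Rightarrow> 'a \<Rightarrow> 'a" where
  "sym3 a b c = a*b*c + a*c*b + b*a*c + b*c*a + c*a*b + c*b*a"

definition alternation :: "('a \<Rightarrow> 'a \<Rightarrow> 'a \<Rightarrow> 'b::ab_group_add) \<Rightarrow> 'a \<Rightarrow> 'a \<Rightarrow> 'a \<Rightarrow> 'b" where
  "alternation F x y z = F x y z + F y z x + F z x y - F x z y - F z y x - F y x z"

text \<open>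
  \<open>A\<close> plays the free algebra without unit and \<open>I\<close> an ideal that contains the cubes of the elements of
  \<open>A\<close>.  Invertibility of $2$ and $3$ appears as divisibility of \<open>I\<close>, so that arguments modulo
  \<open>I\<close> can use integer coefficients only.
\<close>

locale nil3_ideal =
  fixes A I :: "'a::ring_1 set"
  assumes A_add: "x \<in> A \<Longrightarrow> y \<in> A \<Longrightarrow> x + y \<in> A"
    and A_mult [simp]: "x \<in> A \<Longrightarrow> y \<in> A \<Longrightarrow> x * y \<in> A"
    and I_zero: "0 \<in> I"
    and I_add: "x \<in> I \<Longrightarrow> y \<in> I \<Longrightarrow> x + y \<in> I"
    and I_uminus: "x \<in> I \<Longrightarrow> - x \<in> I"
    and I_left: "a \<in> A \<Longrightarrow> x \<in> I \<Longrightarrow> a * x \<in> I"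
    and I_right: "a \<in> A \<Longrightarrow> x \<in> I \<Longrightarrow> x * a \<in> I"
    and I_cube: "a \<in> A \<Longrightarrow> a ^ 3 \<in> I"
    and I_half: "x + x \<in> I \<Longrightarrow> x \<in> I"
    and I_third: "x + x + x \<in> I \<Longrightarrow> x \<in> I"
begin

lemma I_diff: "x \<in> I \<Longrightarrow> y \<in> I \<Longrightarrow> x - y \<in> I"
  using I_add[OF _ I_uminus] by fastforce

lemmas I_linear = I_add I_diff I_uminus I_left I_right

lemma sym3_in_I:
  assumes "a \<in> A" "b \<in> A" "c \<in> A"
  shows "sym3 a b c \<in> I"
proof -
  have "sym3 a b c = (a + b + c) ^ 3 - (a + b) ^ 3 - (a + c) ^ 3 - (b + c) ^ 3 + a ^ 3 + b ^ 3 + c ^ 3"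
    by (simp add: sym3_def power3_eq_cube algebra_simps)
  then show ?thesis
    using assms by (simp add: I_add I_diff I_cube A_add)
qed

text \<open>
  The terms of \<open>sym3 (x*x*b) a c\<close>, \<open>sym3 (x*b) (a*x) c\<close> and \<open>sym3 (a*x*x) b c\<close> together contain
  both wanted words three times.  All their other words fill up to polarizations \<open>sym3 x x _\<close>, which
  express that moving two letters \<open>x\<close> through a product in all ways gives zero.
\<close>

lemma anticommute_square:
  assumes "a \<in> A" "b \<in> A" "c \<in> A" "x \<in> A"
  shows "a * (x * x) * b * c + c * (a * (x * x) * b) \<in> I" (is "?r \<in> I")
proof -
  let ?s = "sym3 (x*x*b) a c + sym3 (x*b) (a*x) c + sym3 (a*x*x) b c"
  have "(?r + ?r + ?r) + (?r + ?r + ?r) =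
      ?s + ?s - sym3 x x (b*a) * c - sym3 x x (b*c*a) - a * sym3 x x c * b - c * sym3 x x (b*a)"
    by (simp add: sym3_def algebra_simps)
  also have "\<dots> \<in> I"
    using assms by (intro I_linear sym3_in_I) simp_all
  finally show ?thesis
    by (blast intro: I_half I_third)
qed

lemma anticommute:
  assumes "a \<in> A" "b \<in> A" "c \<in> A" "x \<in> A" "y \<in> A"
  shows "a * (x * y + y * x) * b * c + c * (a * (x * y + y * x) * b) \<in> I"
proof -
  have "a * (x * y + y * x) * b * c + c * (a * (x * y + y * x) * b) =
      (a * ((x + y) * (x + y)) * b * c + c * (a * ((x + y) * (x + y)) * b))
      - (a * (x * x) * b * c + c * (a * (x * x) * b)) - (a * (y * y) * b * c + c * (a * (y * y) * b))"
    by (simp add: algebra_simps)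
  then show ?thesis
    using assms by (simp add: I_diff anticommute_square A_add)
qed

text \<open>
  Moving \<open>c\<close> and \<open>e\<close> past \<open>X = a * (x * y + y * x) * b\<close> one by one gives \<open>X * c * e = c * e * X\<close>, moving the
  product \<open>c * e\<close> in one go gives the opposite.  So \<open>X\<close> annihilates all products of two further factors,
  on either side of it or around it.
\<close>

lemma anticommute_inside:
  assumes "a \<in> A" "b \<in> A" "c \<in> A" "e \<in> A" "x \<in> A" "y \<in> A"
  shows "a * (x * y + y * x) * b * c * e \<in> I" (is ?l)
    and "c * (a * (x * y + y * x) * b) * e \<in> I" (is ?m)
    and "c * e * (a * (x * y + y * x) * b) \<in> I" (is ?r)
proof -
  define X where "X = a * (x * y + y * x) * b"
  have ac: "X * z + z * X \<in> I" if "z \<in> A" for z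
    unfolding X_def using assms that by (intro anticommute)
  have p: "X * c * e + c * X * e \<in> I" "c * X * e + c * e * X \<in> I" "X * c * e + c * e * X \<in> I"
    using I_right[OF assms(4) ac[OF assms(3)]] I_left[OF assms(3) ac[OF assms(4)]]
      ac[OF A_mult[OF assms(3,4)]]
    by (simp_all add: algebra_simps)
  have "X * c * e + X * c * e =
      (X * c * e + c * X * e) - (c * X * e + c * e * X) + (X * c * e + c * e * X)"
    by simp
  then have 1: "X * c * e \<in> I"
    using p by (metis I_half I_add I_diff)
  have 2: "c * X * e \<in> I"
    using I_diff[OF p(1) 1] by simp
  have 3: "c * e * X \<in> I"
    using I_diff[OF p(3) 1] by simp
  show ?l ?m ?r using 1 2 3 by (simp_all add: X_def)
qed

text \<open>
  \<open>alt\<close> maps each word in \<open>x\<close>, \<open>y\<close>, \<open>z\<close>, \<open>b\<close>, \<open>d\<close> to \<open>\<plusminus>\<close> the alternation of the word with \<open>x\<close>, \<open>y\<close>, \<open>z\<close> in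
  this order.  Thus the alternation of a relation is a combination of at most six such elements, of
  which the equations below involve fourteen.  The weights of the twelve relations in the
  last equation solve this small linear system for twelve times the word \<open>x*b*y*d*z\<close>; no primes other
  than $2$ and $3$ have to be inverted.
\<close>

lemma odd_positions_alternating:
  assumes "x \<in> A" "y \<in> A" "z \<in> A" "b \<in> A" "d \<in> A"
  shows "alternation (\<lambda>x y z. x*b*y*d*z) x y z \<in> I"
proof -
  define alt where "alt F = alternation F x y z" for F :: "'a \<Rightarrow> 'a \<Rightarrow> 'a \<Rightarrow> 'a"
  have alt_in_I: "alt F \<in> I" if "\<And>u v w. u \<in> {x, y, z} \<Longrightarrow> v \<in> {x, y, z} \<Longrightarrow> w \<in> {x, y, z} \<Longrightarrow> F u v w \<in> I" for F
    unfolding alt_def alternation_def using that by (intro I_add I_diff) simp_all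
  have e1: "alt (\<lambda>x y z. sym3 x (y*b) (z*d)) =
      alt (\<lambda>x y z. x*b*y*d*z) + alt (\<lambda>x y z. x*d*y*z*b) + alt (\<lambda>x y z. x*y*b*z*d)
      - alt (\<lambda>x y z. x*b*y*z*d) - alt (\<lambda>x y z. x*d*y*b*z) - alt (\<lambda>x y z. x*y*d*z*b)"
    unfolding alt_def alternation_def sym3_def by (simp add: algebra_simps)
  have e2: "alt (\<lambda>x y z. sym3 x (y*b*z) d) =
      alt (\<lambda>x y z. d*x*b*y*z) + alt (\<lambda>x y z. d*x*y*b*z) + alt (\<lambda>x y z. x*b*y*d*z)
      + alt (\<lambda>x y z. x*b*y*z*d) + alt (\<lambda>x y z. x*d*y*b*z) + alt (\<lambda>x y z. x*y*b*z*d)"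
    unfolding alt_def alternation_def sym3_def by (simp add: algebra_simps)
  have e3: "alt (\<lambda>x y z. x * sym3 y (b*z) d) =
      alt (\<lambda>x y z. x*d*y*b*z) + alt (\<lambda>x y z. x*y*b*z*d) + alt (\<lambda>x y z. x*y*d*b*z)
      - alt (\<lambda>x y z. x*b*y*d*z) - alt (\<lambda>x y z. x*b*y*z*d) - alt (\<lambda>x y z. x*d*b*y*z)"
    unfolding alt_def alternation_def sym3_def by (simp add: algebra_simps)
  have e4: "alt (\<lambda>x y z. sym3 x (y*b) d * z) =
      alt (\<lambda>x y z. d*x*y*b*z) + alt (\<lambda>x y z. x*d*y*b*z) + alt (\<lambda>x y z. x*y*b*d*z)
      - alt (\<lambda>x y z. d*x*b*y*z) - alt (\<lambda>x y z. x*b*d*y*z) - alt (\<lambda>x y z. x*b*y*d*z)"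
    unfolding alt_def alternation_def sym3_def by (simp add: algebra_simps)
  have e5: "alt (\<lambda>x y z. x * sym3 y b d * z) =
      alt (\<lambda>x y z. x*b*d*y*z) + alt (\<lambda>x y z. x*b*y*d*z) + alt (\<lambda>x y z. x*d*b*y*z)
      + alt (\<lambda>x y z. x*d*y*b*z) + alt (\<lambda>x y z. x*y*b*d*z) + alt (\<lambda>x y z. x*y*d*b*z)"
    unfolding alt_def alternation_def sym3_def by (simp add: algebra_simps)
  have e6: "alt (\<lambda>x y z. x * sym3 y b (d*z)) =
      alt (\<lambda>x y z. x*b*y*d*z) + alt (\<lambda>x y z. x*y*b*d*z) + alt (\<lambda>x y z. x*y*d*z*b)
      - alt (\<lambda>x y z. x*b*d*y*z) - alt (\<lambda>x y z. x*d*y*b*z) - alt (\<lambda>x y z. x*d*y*z*b)"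
    unfolding alt_def alternation_def sym3_def by (simp add: algebra_simps)
  have e7: "alt (\<lambda>x y z. sym3 x (y*d*z) b) =
      alt (\<lambda>x y z. b*x*d*y*z) + alt (\<lambda>x y z. b*x*y*d*z) + alt (\<lambda>x y z. x*b*y*d*z)
      + alt (\<lambda>x y z. x*d*y*b*z) + alt (\<lambda>x y z. x*d*y*z*b) + alt (\<lambda>x y z. x*y*d*z*b)"
    unfolding alt_def alternation_def sym3_def by (simp add: algebra_simps)
  have e8: "alt (\<lambda>x y z. sym3 x (y*d) b * z) =
      alt (\<lambda>x y z. b*x*y*d*z) + alt (\<lambda>x y z. x*b*y*d*z) + alt (\<lambda>x y z. x*y*d*b*z)
      - alt (\<lambda>x y z. b*x*d*y*z) - alt (\<lambda>x y z. x*d*b*y*z) - alt (\<lambda>x y z. x*d*y*b*z)"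
    unfolding alt_def alternation_def sym3_def by (simp add: algebra_simps)
  have e9: "alt (\<lambda>x y z. sym3 x (b*y) (d*z)) =
      alt (\<lambda>x y z. b*x*d*y*z) + alt (\<lambda>x y z. d*x*y*b*z) + alt (\<lambda>x y z. x*b*y*d*z)
      - alt (\<lambda>x y z. b*x*y*d*z) - alt (\<lambda>x y z. d*x*b*y*z) - alt (\<lambda>x y z. x*d*y*b*z)"
    unfolding alt_def alternation_def sym3_def by (simp add: algebra_simps)
  have e10: "alt (\<lambda>x y z. y*(b*d + d*b)*z*x + x*(y*(b*d + d*b)*z)) =
      alt (\<lambda>x y z. x*b*d*y*z) + alt (\<lambda>x y z. x*d*b*y*z) + alt (\<lambda>x y z. x*y*b*d*z) + alt (\<lambda>x y z. x*y*d*b*z)"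
    unfolding alt_def alternation_def sym3_def by (simp add: algebra_simps)
  have e11: "alt (\<lambda>x y z. x*(y*d + d*y)*z*b + b*(x*(y*d + d*y)*z)) =
      alt (\<lambda>x y z. b*x*d*y*z) + alt (\<lambda>x y z. b*x*y*d*z) + alt (\<lambda>x y z. x*d*y*z*b) + alt (\<lambda>x y z. x*y*d*z*b)"
    unfolding alt_def alternation_def sym3_def by (simp add: algebra_simps)
  have e12: "alt (\<lambda>x y z. x*(y*b + b*y)*z*d + d*(x*(y*b + b*y)*z)) =
      alt (\<lambda>x y z. d*x*b*y*z) + alt (\<lambda>x y z. d*x*y*b*z) + alt (\<lambda>x y z. x*b*y*z*d) + alt (\<lambda>x y z. x*y*b*z*d)"
    unfolding alt_def alternation_def sym3_def by (simp add: algebra_simps)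
  have t0: "alt (\<lambda>x y z. sym3 x (y*b) (z*d)) \<in> I"
    "alt (\<lambda>x y z. sym3 x (y*b*z) d) \<in> I"
    "alt (\<lambda>x y z. sym3 x (y*d*z) b) \<in> I"
    "alt (\<lambda>x y z. sym3 x (b*y) (d*z)) \<in> I"
    by (rule alt_in_I, rule sym3_in_I; use assms in auto)+
  have t1: "alt (\<lambda>x y z. x * sym3 y (b*z) d) \<in> I"
    "alt (\<lambda>x y z. x * sym3 y b (d*z)) \<in> I"
    by (rule alt_in_I, rule I_left[OF _ sym3_in_I]; use assms in auto)+
  have t2: "alt (\<lambda>x y z. sym3 x (y*b) d * z) \<in> I"
    "alt (\<lambda>x y z. sym3 x (y*d) b * z) \<in> I"
    by (rule alt_in_I, rule I_right[OF _ sym3_in_I]; use assms in auto)+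
  have t3: "alt (\<lambda>x y z. x * sym3 y b d * z) \<in> I"
    by (rule alt_in_I, rule I_right[OF _ I_left[OF _ sym3_in_I]]; use assms in auto)+
  have r: "alt (\<lambda>x y z. y*(b*d + d*b)*z*x + x*(y*(b*d + d*b)*z)) \<in> I"
    "alt (\<lambda>x y z. x*(y*d + d*y)*z*b + b*(x*(y*d + d*y)*z)) \<in> I"
    "alt (\<lambda>x y z. x*(y*b + b*y)*z*d + d*(x*(y*b + b*y)*z)) \<in> I"
    by (rule alt_in_I, rule anticommute; use assms in auto)+
  let ?w = "alt (\<lambda>x y z. x*b*y*d*z)"
  have "(?w + ?w + ?w) + (?w + ?w + ?w) + ((?w + ?w + ?w) + (?w + ?w + ?w)) =
      alt (\<lambda>x y z. sym3 x (y*b) (z*d))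
      + alt (\<lambda>x y z. sym3 x (y*b*z) d)
      + alt (\<lambda>x y z. sym3 x (y*b*z) d)
      - alt (\<lambda>x y z. x * sym3 y (b*z) d)
      - alt (\<lambda>x y z. sym3 x (y*b) d * z)
      + alt (\<lambda>x y z. x * sym3 y b d * z)
      + alt (\<lambda>x y z. x * sym3 y b d * z)
      + alt (\<lambda>x y z. x * sym3 y b (d*z))
      + alt (\<lambda>x y z. sym3 x (y*d*z) b)
      + alt (\<lambda>x y z. sym3 x (y*d*z) b)
      + alt (\<lambda>x y z. sym3 x (y*d) b * z)
      + alt (\<lambda>x y z. sym3 x (b*y) (d*z))
      - alt (\<lambda>x y z. y*(b*d + d*b)*z*x + x*(y*(b*d + d*b)*z))
      - alt (\<lambda>x y z. y*(b*d + d*b)*z*x + x*(y*(b*d + d*b)*z))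
      - alt (\<lambda>x y z. x*(y*d + d*y)*z*b + b*(x*(y*d + d*y)*z))
      - alt (\<lambda>x y z. x*(y*d + d*y)*z*b + b*(x*(y*d + d*y)*z))
      - alt (\<lambda>x y z. x*(y*b + b*y)*z*d + d*(x*(y*b + b*y)*z))
      - alt (\<lambda>x y z. x*(y*b + b*y)*z*d + d*(x*(y*b + b*y)*z))"
    unfolding e1 e2 e3 e4 e5 e6 e7 e8 e9 e10 e11 e12 by simp
  also have "\<dots> \<in> I"
    by (intro I_add I_diff t0 t1 t2 t3 r)
  finally have "?w \<in> I"
    by (rule I_third[OF I_half[OF I_half]])
  then show ?thesis by (simp add: alt_def)
qed

text \<open>
  In $x^2 m s = - (x m s x + m s x^2)$ with \<open>s = z * w + w * z\<close> the right-hand side vanishes because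
  \<open>m * s * x\<close> anticommutes with \<open>x\<close>.
\<close>

lemma sandwiched_squares:
  assumes "x \<in> A" "m \<in> A" "z \<in> A" "w \<in> A"
  shows "x * x * m * (z * w + w * z) \<in> I"
proof -
  let ?s = "m * (z * w + w * z)"
  have q: "x * x * ?s + x * ?s * x + ?s * x * x \<in> I"
  proof (rule I_half)
    show "x * x * ?s + x * ?s * x + ?s * x * x + (x * x * ?s + x * ?s * x + ?s * x * x) \<in> I"
      using sym3_in_I[of x x ?s] assms by (simp add: sym3_def A_add algebra_simps)
  qed
  have "x * x * m * (z * w + w * z) = (x * x * ?s + x * ?s * x + ?s * x * x)
      - (m * (z * w + w * z) * x * x + x * (m * (z * w + w * z) * x))"
    by (simp add: algebra_simps)
  also have "\<dots> \<in> I"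
    using assms by (intro I_diff q anticommute)
  finally show ?thesis .
qed

text \<open>
  Replace \<open>x * b * x\<close> by \<open>- (x*x*b + b*x*x)\<close> in \<open>(x*b*x) * d * x\<close>, move \<open>x\<close> past \<open>b * (x*x) * d\<close>, and replace
  \<open>x * b * x\<close> once more.  What is left contains a cube or two anticommutators with \<open>b\<close> between them.
\<close>

lemma odd_positions_equal:
  assumes "x \<in> A" "b \<in> A" "d \<in> A"
  shows "x*b*x*d*x \<in> I"
proof -
  have q: "x*x*b + x*b*x + b*x*x \<in> I"
  proof (rule I_half)
    show "x*x*b + x*b*x + b*x*x + (x*x*b + x*b*x + b*x*x) \<in> I"
      using sym3_in_I[OF assms(1,1,2)] by (simp add: sym3_def algebra_simps)
  qed
  have "x*b*x*d*x = (x*x*b + x*b*x + b*x*x) * (d*x) + (x*x*b + x*b*x + b*x*x) * (x*d)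
      - (b*(x*x)*d*x + x*(b*(x*x)*d)) - x*x*b*(d*x + x*d) - b * x^3 * d"
    by (simp add: power3_eq_cube algebra_simps)
  also have "\<dots> \<in> I"
    using I_right[OF _ q, of "d*x"] I_right[OF _ q, of "x*d"] anticommute_square[of b d x x]
      sandwiched_squares[of x b d x] I_right[OF _ I_left[OF _ I_cube], of d b x] assms
    by (intro I_diff[OF I_diff[OF I_diff[OF I_add]]]) simp_all
  finally show ?thesis .
qed

text \<open>
  Twice the cyclic sum is the alternating sum plus the symmetric sum over all permutations of \<open>x\<close>,
  \<open>y\<close>, \<open>z\<close>; the latter is the linearization of \<open>x*b*x*d*x\<close>.
\<close>

lemma odd_positions:
  assumes "x \<in> A" "y \<in> A" "z \<in> A" "b \<in> A" "d \<in> A"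
  shows "x*b*y*d*z + y*b*z*d*x + z*b*x*d*y \<in> I" (is "?r \<in> I")
proof -
  define g where "g x = x*b*x*d*x" for x
  have g: "g x \<in> I" if "x \<in> A" for x
    unfolding g_def using that assms by (intro odd_positions_equal)
  have "?r + ?r = alternation (\<lambda>x y z. x*b*y*d*z) x y z
      + (g (x + y + z) - g (x + y) - g (x + z) - g (y + z) + g x + g y + g z)"
    by (simp add: g_def alternation_def algebra_simps)
  also have "\<dots> \<in> I"
    using assms by (intro I_add I_diff odd_positions_alternating g) (simp_all add: A_add)
  finally show ?thesis by (rule I_half)
qed

text \<open>
  Two neighbours that are not at the ends form the anticommutator inside \<open>anticommute_inside\<close>.
\<close>

lemma swap_middle:
  assumes "a \<in> A" "b \<in> A" "c \<in> A" "d \<in> A" "e \<in> A" "f \<in> A"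
  shows swap23: "a*b*c*d*e*f + a*c*b*d*e*f \<in> I"
    and swap34: "a*b*c*d*e*f + a*b*d*c*e*f \<in> I"
    and swap45: "a*b*c*d*e*f + a*b*c*e*d*f \<in> I"
  using anticommute_inside(1)[of a d e f b c] anticommute_inside(2)[of b e a f c d]
    anticommute_inside(3)[of c f a b d e] assms
  by (simp_all add: algebra_simps)

text \<open>
  In \<open>sym3 a b (c*d) * e * f\<close> the terms with \<open>c*d\<close> in front cancel by a swap at positions $3$ and $4$,
  and in the other terms \<open>c*d\<close> moves to positions $3$ and $4$ by two swaps each; hence twice the sum
  is left.  The second part is the mirror image.
\<close>

lemma swap_ends:
  assumes "a \<in> A" "b \<in> A" "c \<in> A" "d \<in> A" "e \<in> A" "f \<in> A"
  shows swap12: "a*b*c*d*e*f + b*a*c*d*e*f \<in> I" (is "?x \<in> I")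
    and swap56: "a*b*c*d*e*f + a*b*c*d*f*e \<in> I" (is "?y \<in> I")
proof -
  have "?x + ?x = sym3 a b (c*d) * e * f
      + ((a*b*c*d*e*f + a*c*b*d*e*f) - (a*c*b*d*e*f + a*c*d*b*e*f))
      + ((b*a*c*d*e*f + b*c*a*d*e*f) - (b*c*a*d*e*f + b*c*d*a*e*f))
      - (c*d*a*b*e*f + c*d*b*a*e*f)"
    by (simp add: sym3_def algebra_simps)
  moreover have "\<dots> \<in> I"
    using assms by (intro I_add I_diff I_right sym3_in_I swap_middle) simp_all
  ultimately show "?x \<in> I" by (metis I_half)
  have "?y + ?y = a * b * sym3 (c*d) e f
      + ((a*b*c*d*e*f + a*b*c*e*d*f) - (a*b*c*e*d*f + a*b*e*c*d*f))
      + ((a*b*c*d*f*e + a*b*c*f*d*e) - (a*b*c*f*d*e + a*b*f*c*d*e))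
      - (a*b*e*f*c*d + a*b*f*e*c*d)"
    by (simp add: sym3_def algebra_simps)
  moreover have "\<dots> \<in> I"
    using assms by (intro I_add I_diff I_left sym3_in_I swap_middle) simp_all
  ultimately show "?y \<in> I" by (metis I_half)
qed

text \<open>
  Exchanging two neighbouring pairs of factors takes four swaps, so it does not change the sign.
\<close>

lemma prod_six_in_I:
  assumes "a \<in> A" "b \<in> A" "c \<in> A" "d \<in> A" "e \<in> A" "f \<in> A"
  shows "a*b*c*d*e*f \<in> I"
proof -
  have l: "a*b*c*d*e*f - c*d*a*b*e*f \<in> I"
    if "a \<in> A" "b \<in> A" "c \<in> A" "d \<in> A" "e \<in> A" "f \<in> A" for a b c d e f
  proof -
    have "a*b*c*d*e*f - c*d*a*b*e*f = ((a*b*c*d*e*f + a*c*b*d*e*f) - (a*c*b*d*e*f + c*a*b*d*e*f))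
      + ((c*a*b*d*e*f + c*a*d*b*e*f) - (c*a*d*b*e*f + c*d*a*b*e*f))"
      by simp
    also have "\<dots> \<in> I" using that by (intro I_add I_diff swap_middle swap_ends)
    finally show ?thesis .
  qed
  have r: "a*b*c*d*e*f - a*b*e*f*c*d \<in> I"
    if "a \<in> A" "b \<in> A" "c \<in> A" "d \<in> A" "e \<in> A" "f \<in> A" for a b c d e f
  proof -
    have "a*b*c*d*e*f - a*b*e*f*c*d = ((a*b*c*d*e*f + a*b*c*e*d*f) - (a*b*c*e*d*f + a*b*e*c*d*f))
      + ((a*b*e*c*d*f + a*b*e*c*f*d) - (a*b*e*c*f*d + a*b*e*f*c*d))"
      by simp
    also have "\<dots> \<in> I" using that by (intro I_add I_diff swap_middle swap_ends)
    finally show ?thesis .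
  qed
  let ?w = "a*b*c*d*e*f"
  let ?l = "?w - c*d*a*b*e*f" and ?r = "?w - a*b*e*f*c*d"
  have "(?w + ?w + ?w) + (?w + ?w + ?w) = sym3 (a*b) (c*d) (e*f)
     + ?l + ?r + (?l + (c*d*a*b*e*f - c*d*e*f*a*b)) + (?r + (a*b*e*f*c*d - e*f*a*b*c*d))
     + (?l + (c*d*a*b*e*f - c*d*e*f*a*b) + (c*d*e*f*a*b - e*f*c*d*a*b))"
    by (simp add: sym3_def mult.assoc)
  also have "\<dots> \<in> I"
    using assms by (intro I_add sym3_in_I l r) simp_all
  finally show ?thesis by (blast intro: I_half I_third)
qed

end

section \<open>The ideal generated by the cubes\<close>

lemma cube_ideal_ideal: "alg_ideal (cube_ideal d) (free_alg d :: ('k::field, _) module)"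
proof -
  have "a \<otimes>\<^bsub>free_alg d\<^esub> x \<in> cube_ideal d \<and> x \<otimes>\<^bsub>free_alg d\<^esub> a \<in> cube_ideal d"
    if "a \<in> carrier (free_alg d)" "x \<in> cube_ideal d" for a x :: "nat list \<Rightarrow>\<^sub>0 'k"
    using that unfolding cube_ideal_def gen_alg_ideal_def alg_ideal_def by blast
  then show ?thesis
    unfolding alg_ideal_def using submodule_cube_ideal by blast
qed

lemma cube_in_cube_ideal: "a \<in> carrier (free_alg d) \<Longrightarrow> a ^ 3 \<in> cube_ideal d"
  unfolding cube_ideal_def gen_alg_ideal_def by blast

lemma cube_ideal_least:
  assumes "alg_ideal J (free_alg d)" "\<And>a. a \<in> carrier (free_alg d) \<Longrightarrow> a ^ 3 \<in> J"
  shows "cube_ideal d \<subseteq> J"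
  unfolding cube_ideal_def gen_alg_ideal_def using assms by blast

lemma two_three_nonzero:
  assumes "CHAR('k::field) = 0 \<or> CHAR('k) > 3"
  shows "(2::'k) \<noteq> 0" "(3::'k) \<noteq> 0"
proof -
  have "of_nat n \<noteq> (0::'k)" if "0 < n" "n \<le> 3" for n
    using assms that by (auto simp: of_nat_eq_0_iff_char_dvd dest: dvd_imp_le)
  from this[of 2] this[of 3] show "(2::'k) \<noteq> 0" "(3::'k) \<noteq> 0" by simp_all
qed

lemma free_alg_mult_closed:
  assumes "a \<in> carrier (free_alg d)" "b \<in> carrier (free_alg d)"
  shows "a * b \<in> carrier (free_alg d)"
  using assms Poly_Mapping.keys_mult[of a b] by (fastforce simp: free_alg_simps plus_list_def)

lemma free_alg_add_closed:
  assumes "a \<in> carrier (free_alg d)" "b \<in> carrier (free_alg d)"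
  shows "a + b \<in> carrier (free_alg d)"
  using assms Poly_Mapping.keys_add[of a b] by (fastforce simp: free_alg_simps)

lemma cube_ideal_scale: "f \<in> cube_ideal d \<Longrightarrow> Poly_Mapping.map ((*) c) f \<in> cube_ideal d"
proof -
  interpret Module.module class_ring "free_alg d" by (rule module_free_alg)
  show "f \<in> cube_ideal d \<Longrightarrow> Poly_Mapping.map ((*) c) f \<in> cube_ideal d"
    using submoduleE(4)[OF submodule_cube_ideal] by (simp add: free_alg_simps)
qed

text \<open>
  Multiplication by a natural number is multiplication by a scalar, which can be inverted.
\<close>

lemma cube_ideal_divide:
  fixes f :: "nat list \<Rightarrow>\<^sub>0 'k::field"
  assumes "of_nat n \<noteq> (0::'k)" "of_nat n * f \<in> cube_ideal d"
  shows "f \<in> cube_ideal d"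
proof -
  have "Poly_Mapping.map ((*) (1 / of_nat n)) (of_nat n * f) =
      Poly_Mapping.single 0 (1 / of_nat n) * (Poly_Mapping.single 0 (of_nat n) * f)"
    by (simp add: mult_map_scale_conv_mult)
  also have "\<dots> = Poly_Mapping.single 0 (1 / of_nat n * of_nat n) * f"
    by (simp only: mult_single mult.assoc[symmetric] add_0)
  also have "\<dots> = f" using assms(1) by simp
  finally show ?thesis using cube_ideal_scale[OF assms(2)] by metis
qed

lemma nil3_ideal_cube_ideal:
  assumes "CHAR('k::field) = 0 \<or> CHAR('k) > 3"
  shows "nil3_ideal (carrier (free_alg d)) (cube_ideal d :: (nat list \<Rightarrow>\<^sub>0 'k) set)"
proof -
  interpret M: Module.module class_ring "free_alg d :: ('k, _) module" by (rule module_free_alg)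
  note sub = submodule_cube_ideal[of d, where 'k = 'k]
  note id = cube_ideal_ideal[of d, where 'k = 'k, unfolded alg_ideal_def free_alg_simps(2)]
  have z: "(0::nat list \<Rightarrow>\<^sub>0 'k) \<in> cube_ideal d"
    using subgroup.one_closed[OF submodule.axioms(1)[OF sub]] by (simp add: free_alg_simps)
  have neg: "- x \<in> cube_ideal d" if "x \<in> cube_ideal d" for x :: "nat list \<Rightarrow>\<^sub>0 'k"
  proof -
    have "- x = Poly_Mapping.map ((*) (-1)) x"
      by (simp add: poly_mapping_eq_iff fun_eq_iff Poly_Mapping.map.rep_eq when_def)
    then show ?thesis using cube_ideal_scale[OF that] by simp
  qed
  show ?thesis
  proof
    fix x y :: "nat list \<Rightarrow>\<^sub>0 'k"
    assume "x \<in> cube_ideal d" "y \<in> cube_ideal d"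
    then show "x + y \<in> cube_ideal d"
      using M.submoduleE(5)[OF sub] by (simp add: free_alg_simps)
  next
    fix x :: "nat list \<Rightarrow>\<^sub>0 'k"
    assume "x + x \<in> cube_ideal d"
    moreover have "x + x = of_nat 2 * x" by (simp add: mult_2)
    ultimately show "x \<in> cube_ideal d"
      using cube_ideal_divide[of 2 x] two_three_nonzero[OF assms] by simp
  next
    fix x :: "nat list \<Rightarrow>\<^sub>0 'k"
    assume "x + x + x \<in> cube_ideal d"
    moreover have "x + x + x = (1 + 1 + 1) * x"
      by (simp only: distrib_right mult_1_left)
    then have "x + x + x = of_nat 3 * x" by simp
    ultimately show "x \<in> cube_ideal d"
      using cube_ideal_divide[of 3 x] two_three_nonzero[OF assms] by simp
    next
    fix a x :: "nat list \<Rightarrow>\<^sub>0 'k"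
    assume "a \<in> carrier (free_alg d)" "x \<in> cube_ideal d"
    then show "a * x \<in> cube_ideal d" "x * a \<in> cube_ideal d" using id by simp_all
  qed (simp_all add: z neg free_alg_add_closed free_alg_mult_closed cube_in_cube_ideal)
qed

abbreviation word :: "nat list \<Rightarrow> (nat list \<Rightarrow>\<^sub>0 'k::field)" where
  "word w \<equiv> Poly_Mapping.single w 1"

lemma word_append: "word (u @ v) = word u * (word v :: nat list \<Rightarrow>\<^sub>0 'k::field)"
  by (simp add: mult_single plus_list_def)

lemma word_Nil: "word [] = (1 :: nat list \<Rightarrow>\<^sub>0 'k::field)"
  by (metis single_one zero_list_def)

lemma word_in_free_alg: "w \<noteq> [] \<Longrightarrow> set w \<subseteq> {1..d} \<Longrightarrow> word w \<in> carrier (free_alg d)"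
  by (simp add: free_alg_simps)

lemma long_word_in_cube_ideal:
  assumes char: "CHAR('k::field) = 0 \<or> CHAR('k) > 3"
    and "length w \<ge> 6" "set w \<subseteq> {1..d}"
  shows "(word w :: nat list \<Rightarrow>\<^sub>0 'k) \<in> cube_ideal d"
proof -
  interpret nil3_ideal "carrier (free_alg d)" "cube_ideal d :: (nat list \<Rightarrow>\<^sub>0 'k) set"
    by (rule nil3_ideal_cube_ideal[OF char])
  obtain a b c e f g v where w: "w = [a] @ [b] @ [c] @ [e] @ [f] @ (g # v)"
    using assms(2) by (auto simp: numeral_eq_Suc Suc_le_length_iff)
  have "word w = word [a] * word [b] * word [c] * word [e] * word [f] * (word (g # v) :: nat list \<Rightarrow>\<^sub>0 'k)"
    unfolding w word_append mult.assoc ..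
  also have "\<dots> \<in> cube_ideal d"
    using assms(3) unfolding w by (intro prod_six_in_I word_in_free_alg) auto
  finally show ?thesis .
qed

section \<open>Linear functionals vanishing on the ideal\<close>


definition lin_ext :: "(nat list \<Rightarrow> 'k::field) \<Rightarrow> (nat list \<Rightarrow>\<^sub>0 'k) \<Rightarrow> 'k" where
  "lin_ext \<phi> f = (\<Sum>w\<in>Poly_Mapping.keys f. Poly_Mapping.lookup f w * \<phi> w)"

lemma lin_ext_superset:
  assumes "finite S" "Poly_Mapping.keys f \<subseteq> S"
  shows "lin_ext \<phi> f = (\<Sum>w\<in>S. Poly_Mapping.lookup f w * \<phi> w)"
  unfolding lin_ext_def using assms by (intro sum.mono_neutral_left) (auto simp: in_keys_iff)

lemma lin_ext_zero [simp]: "lin_ext \<phi> 0 = 0"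
  by (simp add: lin_ext_def)

lemma lin_ext_add: "lin_ext \<phi> (f + g) = lin_ext \<phi> f + lin_ext \<phi> g"
proof -
  let ?S = "Poly_Mapping.keys f \<union> Poly_Mapping.keys g"
  have "lin_ext \<phi> h = (\<Sum>w\<in>?S. Poly_Mapping.lookup h w * \<phi> w)"
    if "Poly_Mapping.keys h \<subseteq> ?S" for h
    using that by (intro lin_ext_superset) auto
  then show ?thesis
    using Poly_Mapping.keys_add[of f g] by (simp add: lookup_add distrib_right sum.distrib)
qed

lemma lin_ext_sum: "lin_ext \<phi> (\<Sum>i\<in>S. f i) = (\<Sum>i\<in>S. lin_ext \<phi> (f i))"
  by (induction S rule: infinite_finite_induct) (simp_all add: lin_ext_add)

lemma lin_ext_single [simp]: "lin_ext \<phi> (Poly_Mapping.single w c) = c * \<phi> w"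
  by (simp add: lin_ext_def)

lemma lin_ext_scale: "lin_ext \<phi> (Poly_Mapping.map ((*) c) f) = c * lin_ext \<phi> f"
proof -
  have "lin_ext \<phi> (Poly_Mapping.map ((*) c) f) =
      (\<Sum>w\<in>Poly_Mapping.keys f. Poly_Mapping.lookup (Poly_Mapping.map ((*) c) f) w * \<phi> w)"
    by (intro lin_ext_superset) (auto dest: keys_scale)
  then show ?thesis
    by (simp add: lin_ext_def sum_distrib_left Poly_Mapping.map.rep_eq when_def mult.assoc in_keys_iff)
qed

lemma sum_of_monomials:
  "(\<Sum>w\<in>Poly_Mapping.keys f. Poly_Mapping.single w (Poly_Mapping.lookup f w)) = f"
  by (rule poly_mapping_eqI) (auto simp: lookup_sum lookup_single when_def in_keys_iff)

lemma lin_ext_mult: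
  "lin_ext \<phi> (f * g) = (\<Sum>u\<in>Poly_Mapping.keys f. Poly_Mapping.lookup f u * lin_ext (\<lambda>v. \<phi> (u @ v)) g)"
proof -
  have "f * g = (\<Sum>u\<in>Poly_Mapping.keys f. \<Sum>v\<in>Poly_Mapping.keys g.
      Poly_Mapping.single u (Poly_Mapping.lookup f u) * Poly_Mapping.single v (Poly_Mapping.lookup g v))"
    by (subst (1 2) sum_of_monomials[symmetric]) (simp only: sum_product)
  then have "lin_ext \<phi> (f * g) = (\<Sum>u\<in>Poly_Mapping.keys f. \<Sum>v\<in>Poly_Mapping.keys g.
      Poly_Mapping.lookup f u * Poly_Mapping.lookup g v * \<phi> (u @ v))"
    by (simp only: lin_ext_sum mult_single plus_list_def lin_ext_single)
  then show ?thesis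
    by (simp add: lin_ext_def sum_distrib_left mult.assoc)
qed

lemma lin_ext_mult_right:
  "lin_ext \<phi> (f * g) = (\<Sum>v\<in>Poly_Mapping.keys g. Poly_Mapping.lookup g v * lin_ext (\<lambda>u. \<phi> (u @ v)) f)"
  unfolding lin_ext_mult unfolding lin_ext_def sum_distrib_left
  by (subst sum.swap) (simp add: mult_ac)

text \<open>
  The condition says that the linear extension of \<open>\<phi>\<close> vanishes on all \<open>s * sym3 a b c * t\<close>.
\<close>

definition kills_cubes :: "(nat list \<Rightarrow> 'k::field) \<Rightarrow> bool" where
  "kills_cubes \<phi> \<longleftrightarrow> (\<forall>s a b c t. a \<noteq> [] \<longrightarrow> b \<noteq> [] \<longrightarrow> c \<noteq> [] \<longrightarrow>
     \<phi> (s@a@b@c@t) + \<phi> (s@a@c@b@t) + \<phi> (s@b@a@c@t) + \<phi> (s@b@c@a@t) + \<phi> (s@c@a@b@t) + \<phi> (s@c@b@a@t) = 0)"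

text \<open>
  The elements on which all translates of \<open>\<phi>\<close> by words \<open>s\<close> and \<open>t\<close> vanish form an ideal.  It contains
  the cubes: on \<open>a ^ 3\<close> six times the form is the sum over all triples of words of \<open>a\<close> and all six orders
  of the triple, which is zero for each triple.
\<close>

lemma cube_ideal_killed:
  fixes \<phi> :: "nat list \<Rightarrow> 'k::field"
  assumes char: "CHAR('k) = 0 \<or> CHAR('k) > 3" and \<phi>: "kills_cubes \<phi>" and f: "f \<in> cube_ideal d"
  shows "lin_ext (\<lambda>w. \<phi> (s @ w @ t)) f = 0"
proof -
  define J where "J = {f \<in> carrier (free_alg d). \<forall>s t. lin_ext (\<lambda>w. \<phi> (s @ w @ t)) f = 0}"
  interpret M: Module.module class_ring "free_alg d :: ('k, _) module" by (rule module_free_alg)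
  have "alg_ideal J (free_alg d)"
    unfolding alg_ideal_def
  proof (intro conjI ballI)
    show "Module.submodule J class_ring (free_alg d)"
    proof (rule M.submoduleI)
      show "J \<subseteq> carrier (free_alg d)" by (auto simp: J_def)
      show "\<zero>\<^bsub>free_alg d\<^esub> \<in> J" by (simp add: J_def free_alg_simps)
      show "x \<oplus>\<^bsub>free_alg d\<^esub> y \<in> J" if "x \<in> J" "y \<in> J" for x y
        using that by (simp add: J_def free_alg_simps(3) free_alg_add_closed lin_ext_add)
      show scale: "c \<odot>\<^bsub>free_alg d\<^esub> x \<in> J" if "x \<in> J" for c x
      proof -
        have "c \<odot>\<^bsub>free_alg d\<^esub> x \<in> carrier (free_alg d)"
          using that M.smult_closed[of c x] by (simp add: J_def)
        then show ?thesis
          using that by (simp add: J_def free_alg_simps(5) lin_ext_scale)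
      qed
      show "\<ominus>\<^bsub>free_alg d\<^esub> x \<in> J" if "x \<in> J" for x
      proof -
        have x: "x \<in> carrier (free_alg d)" using that by (simp add: J_def)
        have "(\<ominus>\<^bsub>class_ring\<^esub> \<one>\<^bsub>class_ring\<^esub>) \<odot>\<^bsub>free_alg d\<^esub> x = \<ominus>\<^bsub>free_alg d\<^esub> x"
          using M.smult_l_minus[of "\<one>\<^bsub>class_ring\<^esub>" x] M.smult_one[OF x] x by simp
        then show ?thesis using scale[OF that] by metis
      qed
    qed
    fix a x :: "nat list \<Rightarrow>\<^sub>0 'k"
    assume a: "a \<in> carrier (free_alg d)" and x: "x \<in> J"
    show "a \<otimes>\<^bsub>free_alg d\<^esub> x \<in> J"
    proof -
      have "lin_ext (\<lambda>w. \<phi> (s @ (u @ w) @ t)) x = 0" for s t u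
        using x[unfolded J_def, simplified, THEN conjunct2, rule_format, of "s @ u" t] by simp
      then show ?thesis
        using a x by (auto simp: J_def lin_ext_mult free_alg_simps(2) free_alg_mult_closed)
    qed
    show "x \<otimes>\<^bsub>free_alg d\<^esub> a \<in> J"
    proof -
      have "lin_ext (\<lambda>w. \<phi> (s @ (w @ u) @ t)) x = 0" for s t u
        using x[unfolded J_def, simplified, THEN conjunct2, rule_format, of s "u @ t"] by simp
      then show ?thesis
        using a x by (auto simp: J_def lin_ext_mult_right free_alg_simps(2) free_alg_mult_closed)
    qed
  qed
  moreover have "a ^ 3 \<in> J" if a: "a \<in> carrier (free_alg d)" for a
  proof -
    have "lin_ext (\<lambda>w. \<phi> (s @ w @ t)) (a * a * a) = 0" for s t
    proof -
      define A where "A = Poly_Mapping.keys a"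
      define g where "g u v w = Poly_Mapping.lookup a u * Poly_Mapping.lookup a v *
          Poly_Mapping.lookup a w * \<phi> (s @ u @ v @ w @ t)" for u v w
      define S where "S = (\<Sum>u\<in>A. \<Sum>v\<in>A. \<Sum>w\<in>A. g u v w)"
      have 1: "S = (\<Sum>u\<in>A. \<Sum>v\<in>A. \<Sum>w\<in>A. g u w v)"
        unfolding S_def by (rule sum.cong[OF refl], rule sum.swap)
      have 2: "S = (\<Sum>u\<in>A. \<Sum>v\<in>A. \<Sum>w\<in>A. g v u w)"
        unfolding S_def by (rule sum.swap)
      have 3: "S = (\<Sum>u\<in>A. \<Sum>v\<in>A. \<Sum>w\<in>A. g v w u)"
        unfolding 1 by (rule sum.swap)
      have 4: "S = (\<Sum>u\<in>A. \<Sum>v\<in>A. \<Sum>w\<in>A. g w u v)"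
        unfolding 2 by (rule sum.cong[OF refl], rule sum.swap)
      have 5: "S = (\<Sum>u\<in>A. \<Sum>v\<in>A. \<Sum>w\<in>A. g w v u)"
        unfolding 4 by (rule sum.swap)
      have "6 * S = S + S + S + S + S + S" by simp
      also have "\<dots> = (\<Sum>u\<in>A. \<Sum>v\<in>A. \<Sum>w\<in>A. g u v w + g u w v + g v u w + g v w u + g w u v + g w v u)"
        unfolding sum.distrib 1[symmetric] 2[symmetric] 3[symmetric] 4[symmetric] 5[symmetric] S_def[symmetric]
        by (rule refl)
      also have "\<dots> = 0"
      proof (intro sum.neutral ballI)
        fix u v w assume "u \<in> A" "v \<in> A" "w \<in> A"
        then have "u \<noteq> []" "v \<noteq> []" "w \<noteq> []" using a by (auto simp: A_def free_alg_simps)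
        then have "\<phi> (s@u@v@w@t) + \<phi> (s@u@w@v@t) + \<phi> (s@v@u@w@t) + \<phi> (s@v@w@u@t)
            + \<phi> (s@w@u@v@t) + \<phi> (s@w@v@u@t) = 0"
          using \<phi> unfolding kills_cubes_def by blast
        then have "Poly_Mapping.lookup a u * Poly_Mapping.lookup a v * Poly_Mapping.lookup a w *
            (\<phi> (s@u@v@w@t) + \<phi> (s@u@w@v@t) + \<phi> (s@v@u@w@t) + \<phi> (s@v@w@u@t)
            + \<phi> (s@w@u@v@t) + \<phi> (s@w@v@u@t)) = 0"
          by simp
        then show "g u v w + g u w v + g v u w + g v w u + g w u v + g w v u = 0"
          by (simp add: g_def algebra_simps)
      qed
      finally have "2 * (3 * S) = 0" by simp
      then have "S = 0" using two_three_nonzero[OF char] by (metis mult_eq_0_iff)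
      moreover have "lin_ext (\<lambda>w. \<phi> (s @ w @ t)) (a * a * a) = S"
        unfolding mult.assoc lin_ext_mult[of _ a] unfolding lin_ext_def S_def g_def A_def
        by (simp add: sum_distrib_left mult_ac)
      ultimately show ?thesis by simp
    qed
    then show ?thesis
      using a by (simp add: J_def power3_eq_cube free_alg_mult_closed)
  qed
  ultimately have "cube_ideal d \<subseteq> J" by (rule cube_ideal_least)
  then show ?thesis using f by (auto simp: J_def)
qed

text \<open>
  A word of length five is evaluated by distinguishing pairs of positions: \<open>G\<close> receives the letters at
  the two distinguished positions and then the other three in their order.  The pairs $34$, $13$, $25$
  count with sign $+$ and $35$, $23$, $14$ with sign $-$.  For \<open>G\<close> that only looks for the letter $2$ at
  both distinguished positions and the letter $1$ at the others, this is up to a scalar the only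
  linear form on multidegree $32$ that vanishes on the ideal, which is where the signs come from.
\<close>

fun top_form :: "(nat \<Rightarrow> nat \<Rightarrow> nat \<Rightarrow> nat \<Rightarrow> nat \<Rightarrow> int) \<Rightarrow> nat list \<Rightarrow> int" where
  "top_form G [a, b, c, d, e] = G c d a b e + G a c b d e + G b e a c d - G c e a b d - G b c a d e - G a d b c e"
| "top_form G _ = 0"

lemma top_form_eq_0: "length w \<noteq> 5 \<Longrightarrow> top_form G w = 0"
  by (cases "(G, w)" rule: top_form.cases) auto

text \<open>
  There are fifteen ways to distribute the lengths of \<open>s\<close>, \<open>a\<close>, \<open>b\<close>, \<open>c\<close>, \<open>t\<close> over a word of length five.  In
  each of them all terms cancel once the arguments of \<open>G\<close> are brought into a normal order.
\<close>

lemma top_form_permutations: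
  assumes sym: "\<And>a b c d e. G a b c d e = G b a c d e"
    and cyc: "\<And>a b c d e. G a b c d e = G a b d e c"
    and ne: "a \<noteq> []" "b \<noteq> []" "c \<noteq> []"
  shows "top_form G (s@a@b@c@t) + top_form G (s@a@c@b@t) + top_form G (s@b@a@c@t) + top_form G (s@b@c@a@t)
    + top_form G (s@c@a@b@t) + top_form G (s@c@b@a@t) = 0"
proof (cases "length (s@a@b@c@t) = 5")
  case False
  then have "length (s@a@b@c@t) \<noteq> 5" "length (s@a@c@b@t) \<noteq> 5" "length (s@b@a@c@t) \<noteq> 5"
    "length (s@b@c@a@t) \<noteq> 5" "length (s@c@a@b@t) \<noteq> 5" "length (s@c@b@a@t) \<noteq> 5"
    by simp_all
  then show ?thesis by (simp add: top_form_eq_0)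
next
  case True
  have cyc': "G a b c d e = G a b e c d" for a b c d e by (metis cyc)
  obtain a0 a' b0 b' c0 c' where abc: "a = a0 # a'" "b = b0 # b'" "c = c0 # c'"
    using ne by (metis list.exhaust)
  have len: "length s + length a' + length b' + length c' + length t = 2"
    using True by (simp add: abc)
  have short: "l = [] \<or> (\<exists>x. l = [x]) \<or> (\<exists>x y. l = [x, y])" if "length l \<le> 2" for l :: "nat list"
    using that by (auto simp: le_Suc_eq length_Suc_conv numeral_2_eq_2)
  have "length s \<le> 2" "length a' \<le> 2" "length b' \<le> 2" "length c' \<le> 2" "length t \<le> 2"
    using len by simp_all
  note short[OF this(1)] short[OF this(2)] short[OF this(3)] short[OF this(4)] short[OF this(5)]
  then show ?thesis
    using len unfolding abc by (elim disjE exE; simp add: sym cyc cyc')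
qed

section \<open>Linear independence\<close>

text \<open>
  A marking \<open>(x, y, p, q, r)\<close> stands for the smallest function that \<open>top_form\<close> admits: the indicator
  function of the pair \<open>{x, y}\<close> together with the cyclic order \<open>p, q, r\<close>.  A dual system lists words, each with
  a combination of such forms, given by coefficients, the padding on the left and on the right, and
  the marking.
\<close>

type_synonym marking = "nat \<times> nat \<times> nat \<times> nat \<times> nat"
type_synonym dual_system = "(nat list \<times> (int \<times> nat list \<times> nat list \<times> marking) list) list"

definition indicator_form :: "marking \<Rightarrow> nat \<Rightarrow> nat \<Rightarrow> nat \<Rightarrow> nat \<Rightarrow> nat \<Rightarrow> int" where
  "indicator_form m a b c d e = (case m of (x, y, p, q, r) \<Rightarrow> of_bool
     ((a = x \<and> b = y \<or> a = y \<and> b = x) \<and>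
      (c = p \<and> d = q \<and> e = r \<or> c = q \<and> d = r \<and> e = p \<or> c = r \<and> d = p \<and> e = q)))"

lemma indicator_form_symmetric: "indicator_form m a b c d e = indicator_form m b a c d e"
  by (simp add: indicator_form_def conj_commute disj_commute split: prod.split)

lemma indicator_form_cyclic: "indicator_form m a b c d e = indicator_form m a b d e c"
  by (simp add: indicator_form_def conj_ac disj_ac split: prod.split)

lemma indicator_form_kills_cubes: "kills_cubes (\<lambda>w. of_int (top_form (indicator_form m) w) :: 'k::field)"
proof -
  show ?thesis
    unfolding kills_cubes_def of_int_add[symmetric]
  proof (intro allI impI)
    fix s a b c t :: "nat list" assume "a \<noteq> []" "b \<noteq> []" "c \<noteq> []"
    from top_form_permutations[OF indicator_form_symmetric indicator_form_cyclic this]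
    show "of_int (top_form (indicator_form m) (s @ a @ b @ c @ t) + top_form (indicator_form m) (s @ a @ c @ b @ t)
      + top_form (indicator_form m) (s @ b @ a @ c @ t) + top_form (indicator_form m) (s @ b @ c @ a @ t)
      + top_form (indicator_form m) (s @ c @ a @ b @ t) + top_form (indicator_form m) (s @ c @ b @ a @ t)) = (0::'k)"
      by (simp only: of_int_0)
  qed
qed

definition pairing :: "(int \<times> nat list \<times> nat list \<times> marking) list \<Rightarrow> nat list \<Rightarrow> int" where
  "pairing f w = (\<Sum>(c, s, t, m)\<leftarrow>f. c * top_form (indicator_form m) (s @ w @ t))"

primrec triangular :: "dual_system \<Rightarrow> bool" where
  "triangular [] \<longleftrightarrow> True"
| "triangular (x # xs) \<longleftrightarrow> pairing (snd x) (fst x) \<in> {1, - 1, 2, - 2, 3, - 3} \<and>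
     list_all (\<lambda>y. fst y \<noteq> fst x \<and> pairing (snd x) (fst y) = 0) xs \<and> triangular xs"

lemma lin_ext_pairing:
  fixes f :: "nat list \<Rightarrow>\<^sub>0 'k::field"
  assumes "CHAR('k) = 0 \<or> CHAR('k) > 3" "f \<in> cube_ideal d"
  shows "lin_ext (\<lambda>w. of_int (pairing g w)) f = 0"
proof (induction g)
  case Nil
  then show ?case by (simp add: pairing_def lin_ext_def)
next
  case (Cons x g)
  obtain c s t m where x: "x = (c, s, t, m)" by (cases x)
  have "lin_ext (\<lambda>w. of_int (pairing (x # g) w)) f =
      of_int c * lin_ext (\<lambda>w. of_int (top_form (indicator_form m) (s @ w @ t))) f + lin_ext (\<lambda>w. of_int (pairing g w)) f"
    by (simp add: x pairing_def lin_ext_def sum.distrib sum_distrib_left distrib_left mult.left_commute)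
  then show ?case
    using Cons cube_ideal_killed[OF assms(1) indicator_form_kills_cubes assms(2)] by simp
qed

text \<open>
  The combination of forms that belongs to the first word vanishes on all later words, so it extracts the
  coefficient of the first word up to an invertible factor.
\<close>

lemma triangular_independent:
  fixes c :: "nat list \<Rightarrow> 'k::field"
  assumes char: "CHAR('k) = 0 \<or> CHAR('k) > 3"
    and "triangular xs"
    and "(\<Sum>b\<in>set (map fst xs). Poly_Mapping.single b (c b)) \<in> cube_ideal d"
  shows "\<forall>b\<in>set (map fst xs). c b = 0"
  using assms(2,3)
proof (induction xs)
  case (Cons x xs)
  let ?B = "set (map fst xs)"
  have x: "fst x \<notin> ?B" using Cons.prems(1) by (auto simp: list_all_iff)
  have zero: "pairing (snd x) b = 0" if "b \<in> ?B" for b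
    using Cons.prems(1) that by (auto simp: list_all_iff)
  have "of_int (pairing (snd x) (fst x)) \<noteq> (0::'k)"
    using Cons.prems(1) two_three_nonzero[OF char] by auto
  moreover have "0 = lin_ext (\<lambda>w. of_int (pairing (snd x) w)) (\<Sum>b\<in>set (map fst (x # xs)). Poly_Mapping.single b (c b))"
    using lin_ext_pairing[OF char Cons.prems(2)] by simp
  moreover have "\<dots> = c (fst x) * of_int (pairing (snd x) (fst x))"
    using x zero by (simp add: lin_ext_sum lin_ext_add)
  ultimately have "c (fst x) = 0" by simp
  then show ?case
    using Cons x by simp
qed simp

section \<open>Spanning\<close>

text \<open>
  The relations are sums of words with coefficient $1$: \<open>Cube u a b c v\<close> stands for
  \<open>u * sym3 a b c * v\<close>, \<open>Anti\<close> for \<open>anticommute\<close> and \<open>Odd\<close> for \<open>odd_positions\<close>.  A derivation is a list of integer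
  combinations of relations.
\<close>

datatype relation =
    Cube "nat list" "nat list" "nat list" "nat list" "nat list"
  | Anti "nat list" "nat list" "nat list" "nat list" "nat list"
  | Odd "nat list" "nat list" "nat list" "nat list" "nat list"

type_synonym derivation = "(int \<times> relation) list list"

primrec relation_words :: "relation \<Rightarrow> nat list list" where
  "relation_words (Cube u a b c v) = map (\<lambda>w. u @ w @ v)
     [a @ b @ c, a @ c @ b, b @ a @ c, b @ c @ a, c @ a @ b, c @ b @ a]"
| "relation_words (Anti a x y b c) =
     [a @ x @ y @ b @ c, a @ y @ x @ b @ c, c @ a @ x @ y @ b, c @ a @ y @ x @ b]"
| "relation_words (Odd x b y e z) = [x @ b @ y @ e @ z, y @ b @ z @ e @ x, z @ b @ x @ e @ y]"

primrec proper :: "nat \<Rightarrow> relation \<Rightarrow> bool" where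
  "proper d (Cube u a b c v) \<longleftrightarrow> list_all (\<lambda>w. w \<noteq> []) [a, b, c] \<and> list_all (\<lambda>i. 1 \<le> i \<and> i \<le> d) (u @ a @ b @ c @ v)"
| "proper d (Anti a x y b c) \<longleftrightarrow> list_all (\<lambda>w. w \<noteq> []) [a, x, y, b, c] \<and> list_all (\<lambda>i. 1 \<le> i \<and> i \<le> d) (a @ x @ y @ b @ c)"
| "proper d (Odd x b y e z) \<longleftrightarrow>
     list_all (\<lambda>w. w \<noteq> []) [x, b, y, e, z] \<and> list_all (\<lambda>i. 1 \<le> i \<and> i \<le> d) (x @ b @ y @ e @ z)"

definition once :: "relation \<Rightarrow> (int \<times> relation) list" where
  "once r = [(1, r)]"

text \<open>
  For letters \<open>u = v = []\<close> and \<open>a, b, c, e = 1, 2, 3, 4\<close> this combination leaves twice the word $4132$ and nine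
  basis words of multidegree $1^4$.  Single relations do not lead from these basis words to $4132$.
\<close>

definition quartic :: "nat list \<Rightarrow> nat list \<Rightarrow> nat list \<Rightarrow> nat list \<Rightarrow> nat list \<Rightarrow> nat list \<Rightarrow> (int \<times> relation) list" where
  "quartic u a b c e v = [(- 1, Cube u a b e (c @ v)), (- 1, Cube u a (b @ e) c v),
     (1, Cube u (a @ c) b e v), (1, Cube (u @ b) a c e v), (1, Cube u b c (e @ a) v)]"

definition terms_of :: "(int \<times> relation) list \<Rightarrow> (int \<times> nat list) list" where
  "terms_of st = concat (map (\<lambda>(c, r). map (\<lambda>w. (c, w)) (relation_words r)) st)"

definition coefficient :: "(int \<times> nat list) list \<Rightarrow> nat list \<Rightarrow> int" where
  "coefficient ts w = sum_list (map fst (filter (\<lambda>t. snd t = w) ts))"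

text \<open>
  If all words with nonzero coefficient in the combination \<open>st\<close> belong to \<open>ws\<close> except one, whose
  coefficient divides $12$ and hence is invertible, this word is added to \<open>ws\<close>; otherwise \<open>ws\<close> stays as it is.
\<close>

definition resolve :: "nat \<Rightarrow> (int \<times> relation) list \<Rightarrow> nat list list \<Rightarrow> nat list list" where
  "resolve d st ws = (let ts = terms_of st in
     case filter (\<lambda>w. coefficient ts w \<noteq> 0) (filter (\<lambda>w. w \<notin> set ws) (remdups (map snd ts))) of
       [w] \<Rightarrow> if coefficient ts w dvd 12 \<and> list_all (\<lambda>(c, r). proper d r) st then w # ws else ws
     | _ \<Rightarrow> ws)"

primrec arrangements :: "nat list \<Rightarrow> nat list list" where
  "arrangements [] = [[]]"
| "arrangements (x # xs) =
     concat (map (\<lambda>w. map (\<lambda>k. take k w @ x # drop k w) [0..<Suc (length w)]) (arrangements xs))"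

definition covers :: "nat list list \<Rightarrow> nat list list \<Rightarrow> bool" where
  "covers ws vs \<longleftrightarrow> list_all (\<lambda>v. v \<in> set ws) vs"

definition spanned :: "nat \<Rightarrow> nat list set \<Rightarrow> (nat list \<Rightarrow>\<^sub>0 'k::field) set" where
  "spanned d B = {f. \<exists>c. f - (\<Sum>b\<in>B. Poly_Mapping.single b (c b)) \<in> cube_ideal d}"

lemma relation_in_cube_ideal:
  assumes char: "CHAR('k::field) = 0 \<or> CHAR('k) > 3" and r: "proper d r"
  shows "(\<Sum>w\<leftarrow>relation_words r. word w :: nat list \<Rightarrow>\<^sub>0 'k) \<in> cube_ideal d"
proof -
  interpret nil3_ideal "carrier (free_alg d)" "cube_ideal d :: (nat list \<Rightarrow>\<^sub>0 'k) set"
    by (rule nil3_ideal_cube_ideal[OF char])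
  have W: "word w \<in> carrier (free_alg d)" if "w \<noteq> []" "list_all (\<lambda>i. 1 \<le> i \<and> i \<le> d) w" for w
    using that by (intro word_in_free_alg) (auto simp: list_all_iff)
  show ?thesis
  proof (cases r)
    case (Cube u a b c v)
    then have T: "sym3 (word a) (word b) (word c) \<in> (cube_ideal d :: (nat list \<Rightarrow>\<^sub>0 'k) set)"
      using r by (intro sym3_in_I W) simp_all
    have R: "sym3 (word a) (word b) (word c) * word v \<in> (cube_ideal d :: (nat list \<Rightarrow>\<^sub>0 'k) set)"
      by (cases "v = []") (use T I_right[OF W T, of v] r Cube in \<open>simp_all add: word_Nil\<close>)
    have "word u * (sym3 (word a) (word b) (word c) * word v) \<in> (cube_ideal d :: (nat list \<Rightarrow>\<^sub>0 'k) set)"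
      by (cases "u = []") (use R I_left[OF W R, of u] r Cube in \<open>simp_all add: word_Nil\<close>)
    also have "word u * (sym3 (word a) (word b) (word c) * word v) = (\<Sum>w\<leftarrow>relation_words r. word w :: nat list \<Rightarrow>\<^sub>0 'k)"
      by (simp only: Cube relation_words.simps list.map sum_list.Cons sum_list.Nil word_append sym3_def)
        (simp add: algebra_simps)
    finally show ?thesis .
  next
    case (Anti a x y b c)
    have "word a * (word x * word y + word y * word x) * word b * word c
        + word c * (word a * (word x * word y + word y * word x) * word b)
        \<in> (cube_ideal d :: (nat list \<Rightarrow>\<^sub>0 'k) set)"
      using r Anti by (intro anticommute W) simp_all
    also have "word a * (word x * word y + word y * word x) * word b * word c
        + word c * (word a * (word x * word y + word y * word x) * word b)
        = (\<Sum>w\<leftarrow>relation_words r. word w :: nat list \<Rightarrow>\<^sub>0 'k)"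
      by (simp only: Anti relation_words.simps list.map sum_list.Cons sum_list.Nil word_append)
        (simp add: algebra_simps)
    finally show ?thesis .
  next
    case (Odd x b y e z)
    have "word x * word b * word y * word e * word z + word y * word b * word z * word e * word x
        + word z * word b * word x * word e * word y \<in> (cube_ideal d :: (nat list \<Rightarrow>\<^sub>0 'k) set)"
      using r Odd by (intro odd_positions W) simp_all
    also have "word x * word b * word y * word e * word z + word y * word b * word z * word e * word x
        + word z * word b * word x * word e * word y = (\<Sum>w\<leftarrow>relation_words r. word w :: nat list \<Rightarrow>\<^sub>0 'k)"
      by (simp only: Odd relation_words.simps list.map sum_list.Cons sum_list.Nil word_append)
        (simp add: algebra_simps)
    finally show ?thesis .
  qed
qed

definition combination :: "(int \<times> nat list) list \<Rightarrow> (nat list \<Rightarrow>\<^sub>0 'k::field)" where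
  "combination ts = (\<Sum>(c, w)\<leftarrow>ts. Poly_Mapping.single w (of_int c))"

lemma combination_collect:
  "combination ts = (\<Sum>w\<in>set (map snd ts). Poly_Mapping.single w (of_int (coefficient ts w) :: 'k::field))"
proof (rule poly_mapping_eqI)
  fix v
  have "Poly_Mapping.lookup (combination ts) v = (of_int (coefficient ts v) :: 'k)"
    by (induction ts) (auto simp: combination_def coefficient_def lookup_add lookup_single)
  moreover have "coefficient ts v = 0" if "v \<notin> set (map snd ts)"
  proof -
    have "filter (\<lambda>t. snd t = v) ts = []" using that by (auto simp: filter_empty_conv)
    then show ?thesis by (simp add: coefficient_def)
  qed
  ultimately show "Poly_Mapping.lookup (combination ts) v =
      Poly_Mapping.lookup (\<Sum>w\<in>set (map snd ts). Poly_Mapping.single w (of_int (coefficient ts w) :: 'k)) v"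
    by (auto simp: lookup_sum lookup_single when_def)
qed

lemma terms_in_cube_ideal:
  assumes char: "CHAR('k::field) = 0 \<or> CHAR('k) > 3"
    and "list_all (\<lambda>(c, r). proper d r) st"
  shows "(combination (terms_of st) :: nat list \<Rightarrow>\<^sub>0 'k) \<in> cube_ideal d"
  using assms(2)
proof (induction st)
  interpret nil3_ideal "carrier (free_alg d)" "cube_ideal d :: (nat list \<Rightarrow>\<^sub>0 'k) set"
    by (rule nil3_ideal_cube_ideal[OF char])
  case Nil
  then show ?case by (simp add: combination_def terms_of_def I_zero)
next
  interpret nil3_ideal "carrier (free_alg d)" "cube_ideal d :: (nat list \<Rightarrow>\<^sub>0 'k) set"
    by (rule nil3_ideal_cube_ideal[OF char])
  case (Cons x st)
  obtain c r where x: "x = (c, r)" by (cases x)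
  have "combination (map (\<lambda>w. (c, w)) ws) = Poly_Mapping.map ((*) (of_int c)) (\<Sum>w\<leftarrow>ws. word w :: nat list \<Rightarrow>\<^sub>0 'k)" for ws
    unfolding mult_map_scale_conv_mult
    by (induction ws) (simp_all add: combination_def distrib_left mult_single del: single_of_int)
  then have "combination (terms_of (x # st)) =
      Poly_Mapping.map ((*) (of_int c)) (\<Sum>w\<leftarrow>relation_words r. word w :: nat list \<Rightarrow>\<^sub>0 'k) + combination (terms_of st)"
    by (simp add: x terms_of_def combination_def)
  then show ?case
    using Cons by (simp add: x I_add cube_ideal_scale relation_in_cube_ideal[OF char])
qed

context
  fixes d :: nat and B :: "nat list set"
  assumes char: "CHAR('k::field) = 0 \<or> CHAR('k) > 3" and B: "finite B"
begin

interpretation nil3_ideal "carrier (free_alg d)" "cube_ideal d :: (nat list \<Rightarrow>\<^sub>0 'k) set"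
  by (rule nil3_ideal_cube_ideal[OF char])

lemma spanned_cube_ideal: "f \<in> cube_ideal d \<Longrightarrow> f \<in> (spanned d B :: (nat list \<Rightarrow>\<^sub>0 'k) set)"
  unfolding spanned_def by (auto intro!: exI[of _ "\<lambda>_. 0"])

lemma spanned_word: "b \<in> B \<Longrightarrow> word b \<in> (spanned d B :: (nat list \<Rightarrow>\<^sub>0 'k) set)"
proof -
  assume b: "b \<in> B"
  have "(\<Sum>v\<in>B. Poly_Mapping.single v (if v = b then 1 else 0 :: 'k)) = (\<Sum>v\<in>B. if v = b then word b else 0)"
    by (intro sum.cong) auto
  also have "\<dots> = word b" using b B by simp
  finally show ?thesis
    unfolding spanned_def using I_zero by (auto intro!: exI[of _ "\<lambda>v. if v = b then 1 else 0"])
qed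

lemma spanned_add:
  assumes "f \<in> spanned d B" "g \<in> (spanned d B :: (nat list \<Rightarrow>\<^sub>0 'k) set)"
  shows "f + g \<in> spanned d B"
proof -
  from assms obtain c e where
    "f - (\<Sum>b\<in>B. Poly_Mapping.single b (c b)) \<in> cube_ideal d"
    "g - (\<Sum>b\<in>B. Poly_Mapping.single b (e b)) \<in> cube_ideal d"
    unfolding spanned_def by blast
  from I_add[OF this] have "f + g - (\<Sum>b\<in>B. Poly_Mapping.single b (c b + e b)) \<in> cube_ideal d"
    by (simp add: single_add sum.distrib algebra_simps)
  then show ?thesis
    unfolding spanned_def by (intro CollectI exI[of _ "\<lambda>b. c b + e b"])
qed

lemma spanned_diff:
  assumes "f \<in> spanned d B" "g \<in> (spanned d B :: (nat list \<Rightarrow>\<^sub>0 'k) set)"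
  shows "f - g \<in> spanned d B"
proof -
  from assms obtain c e where
    "f - (\<Sum>b\<in>B. Poly_Mapping.single b (c b)) \<in> cube_ideal d"
    "g - (\<Sum>b\<in>B. Poly_Mapping.single b (e b)) \<in> cube_ideal d"
    unfolding spanned_def by blast
  from I_diff[OF this] have "f - g - (\<Sum>b\<in>B. Poly_Mapping.single b (c b - e b)) \<in> cube_ideal d"
    by (simp add: single_diff sum_subtractf algebra_simps)
  then show ?thesis
    unfolding spanned_def by (intro CollectI exI[of _ "\<lambda>b. c b - e b"])
qed

lemma spanned_scale:
  assumes "f \<in> (spanned d B :: (nat list \<Rightarrow>\<^sub>0 'k) set)"
  shows "Poly_Mapping.map ((*) k) f \<in> spanned d B"
proof -
  from assms obtain c where c: "f - (\<Sum>b\<in>B. Poly_Mapping.single b (c b)) \<in> cube_ideal d"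
    unfolding spanned_def by blast
  have "Poly_Mapping.map ((*) k) (f - (\<Sum>b\<in>B. Poly_Mapping.single b (c b))) =
      Poly_Mapping.map ((*) k) f - (\<Sum>b\<in>B. Poly_Mapping.single b (k * c b))"
    by (simp add: mult_map_scale_conv_mult right_diff_distrib sum_distrib_left mult_single)
  then show ?thesis
    using cube_ideal_scale[OF c, of k] unfolding spanned_def by auto
qed

lemma spanned_sum:
  "(\<And>i. i \<in> S \<Longrightarrow> f i \<in> spanned d B) \<Longrightarrow> (\<Sum>i\<in>S. f i) \<in> (spanned d B :: (nat list \<Rightarrow>\<^sub>0 'k) set)"
  by (induction S rule: infinite_finite_induct)
    (simp_all add: spanned_add spanned_cube_ideal I_zero)

lemma single_spanned:
  assumes "word w \<in> (spanned d B :: (nat list \<Rightarrow>\<^sub>0 'k) set)"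
  shows "Poly_Mapping.single w k \<in> (spanned d B :: (nat list \<Rightarrow>\<^sub>0 'k) set)"
  using spanned_scale[OF assms, of k] by simp

text \<open>
  The combination belongs to the ideal.  Subtracting the terms whose words are already known to be
  spanned leaves a multiple of the new word by an invertible scalar.
\<close>

lemma resolve_spanned:
  assumes "\<forall>w\<in>set ws. word w \<in> (spanned d B :: (nat list \<Rightarrow>\<^sub>0 'k) set)"
  shows "\<forall>w\<in>set (resolve d st ws). word w \<in> (spanned d B :: (nat list \<Rightarrow>\<^sub>0 'k) set)"
proof -
  define ts where "ts = terms_of st"
  define new where "new = filter (\<lambda>w. coefficient ts w \<noteq> 0) (filter (\<lambda>w. w \<notin> set ws) (remdups (map snd ts)))"
  have res: "resolve d st ws = (case new of
       [w] \<Rightarrow> if coefficient ts w dvd 12 \<and> list_all (\<lambda>(c, r). proper d r) st then w # ws else ws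
     | _ \<Rightarrow> ws)"
    unfolding resolve_def Let_def ts_def[symmetric] new_def[symmetric] by (rule refl)
  then consider "resolve d st ws = ws"
    | v where "resolve d st ws = v # ws" "new = [v]" "coefficient ts v dvd 12" "list_all (\<lambda>(c, r). proper d r) st"
  proof (cases new)
    case (Cons v vs)
    then show ?thesis using res that by (cases vs; cases "coefficient ts v dvd 12 \<and> list_all (\<lambda>(c, r). proper d r) st") simp_all
  qed (use res that in simp)
  then show ?thesis
  proof cases
    case 1
    then show ?thesis using assms by (simp only:)
  next
    case (2 v)
    let ?V = "set (map snd ts)" and ?m = "\<lambda>w. Poly_Mapping.single w (of_int (coefficient ts w) :: 'k)"
    have "set new = {v}" by (simp add: 2(2))
    then have other: "w \<in> set ws \<or> coefficient ts w = 0" if "w \<in> ?V - {v}" for w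
      using that by (auto simp: new_def)
    have v: "v \<in> ?V" using \<open>set new = {v}\<close> by (auto simp: new_def)
    have "?m w \<in> spanned d B" if w: "w \<in> ?V - {v}" for w
    proof (cases "coefficient ts w = 0")
      case True
      then show ?thesis using spanned_cube_ideal[OF I_zero] by (simp only: of_int_0 single_zero)
    next
      case False
      then have "w \<in> set ws" using other[OF w] by simp
      then have "(word w :: nat list \<Rightarrow>\<^sub>0 'k) \<in> spanned d B" using assms by blast
      then show ?thesis by (rule single_spanned)
    qed
    then have rest: "(\<Sum>w\<in>?V - {v}. ?m w) \<in> spanned d B" by (rule spanned_sum)
    have "?m v + (\<Sum>w\<in>?V - {v}. ?m w) = combination ts"
      unfolding combination_collect by (rule sum.remove[symmetric]) (use v in simp_all)
    also have "(combination ts :: nat list \<Rightarrow>\<^sub>0 'k) \<in> spanned d B"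
      unfolding ts_def by (intro spanned_cube_ideal terms_in_cube_ideal[OF char 2(4)])
    finally have mv: "?m v \<in> spanned d B"
      using spanned_diff[OF _ rest] by (metis add_diff_cancel_right')
    have "(12::'k) = 2 * 2 * 3" by simp
    then have "(12::'k) \<noteq> 0"
      using two_three_nonzero[OF char] by (simp only: mult_eq_0_iff not_False_eq_True de_Morgan_disj simp_thms)
    moreover obtain k where "12 = coefficient ts v * k" using 2(3) unfolding dvd_def by blast
    from arg_cong[OF this, of "of_int :: int \<Rightarrow> 'k"]
    have "(12::'k) = of_int (coefficient ts v) * of_int k" by simp
    ultimately have nz: "of_int (coefficient ts v) \<noteq> (0::'k)" by (metis mult_zero_left)
    have "word v = Poly_Mapping.map ((*) (1 / of_int (coefficient ts v))) (?m v)"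
      using nz by simp
    also have "\<dots> \<in> spanned d B" by (rule spanned_scale[OF mv])
    finally show ?thesis using assms unfolding 2(1) by simp
  qed
qed

lemma fold_resolve_spanned:
  assumes "\<forall>w\<in>set ws. word w \<in> (spanned d B :: (nat list \<Rightarrow>\<^sub>0 'k) set)"
  shows "\<forall>w\<in>set (fold (resolve d) sts ws). word w \<in> (spanned d B :: (nat list \<Rightarrow>\<^sub>0 'k) set)"
  using assms
proof (induction sts arbitrary: ws)
  case (Cons st sts)
  show ?case
    unfolding fold_Cons o_apply by (rule Cons.IH[OF resolve_spanned[OF Cons.prems]])
qed simp

end

lemma arrangements_complete: "mset w = mset xs \<Longrightarrow> w \<in> set (arrangements xs)"
proof (induction xs arbitrary: w)
  case (Cons x xs)
  then have "x \<in> set w"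
    by (metis list.set_intros(1) set_mset_mset)
  then obtain u v where w: "w = u @ x # v" by (meson split_list)
  then have "mset (u @ v) = mset xs" using Cons.prems by simp
  then have "u @ v \<in> set (arrangements xs)" by (rule Cons.IH)
  moreover have "w \<in> (\<lambda>k. take k (u @ v) @ x # drop k (u @ v)) ` set [0..<Suc (length (u @ v))]"
    by (rule image_eqI[of _ _ "length u"]) (simp_all add: w)
  ultimately show ?case
    unfolding arrangements.simps set_concat set_map image_image by (rule UN_I)
qed simp

lemma covers_spanned:
  assumes "CHAR('k::field) = 0 \<or> CHAR('k) > 3"
    and "covers (fold (resolve d) sts bs) (arrangements xs)" and "mset w = mset xs"
  shows "word w \<in> (spanned d (set bs) :: (nat list \<Rightarrow>\<^sub>0 'k) set)"
proof -
  have "\<forall>b\<in>set bs. word b \<in> (spanned d (set bs) :: (nat list \<Rightarrow>\<^sub>0 'k) set)"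
    using spanned_word[OF assms(1), of "set bs"] by simp
  from fold_resolve_spanned[OF assms(1) _ this] show ?thesis
    using assms(2) arrangements_complete[OF assms(3)] by (auto simp: covers_def list_all_iff)
qed

section \<open>Bases of the homogeneous components\<close>

lemma nil3_class_eq_iff:
  fixes f g :: "nat list \<Rightarrow>\<^sub>0 'k::field"
  assumes char: "CHAR('k) = 0 \<or> CHAR('k) > 3"
  shows "nil3_class d f = nil3_class d g \<longleftrightarrow> f - g \<in> cube_ideal d"
proof -
  interpret nil3_ideal "carrier (free_alg d)" "cube_ideal d :: (nat list \<Rightarrow>\<^sub>0 'k) set"
    by (rule nil3_ideal_cube_ideal[OF char])
  have coset: "nil3_class d h = (\<lambda>i. i + h) ` cube_ideal d" for h :: "nat list \<Rightarrow>\<^sub>0 'k"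
    unfolding nil3_class_def a_r_coset_def' free_alg_simps by blast
  have sub: "nil3_class d f \<subseteq> nil3_class d g" if "f - g \<in> cube_ideal d" for f g :: "nat list \<Rightarrow>\<^sub>0 'k"
  proof
    fix x assume "x \<in> nil3_class d f"
    then obtain i where i: "i \<in> cube_ideal d" "x = i + f" unfolding coset by blast
    then have "x = (i + (f - g)) + g" by simp
    then show "x \<in> nil3_class d g"
      unfolding coset using I_add[OF i(1) that] by blast
  qed
  show ?thesis
  proof
    assume "nil3_class d f = nil3_class d g"
    moreover have "f \<in> nil3_class d f" unfolding coset using I_zero by force
    ultimately obtain i where "i \<in> cube_ideal d" "f = i + g" unfolding coset by blast
    then show "f - g \<in> cube_ideal d" by simp
  next
    assume "f - g \<in> cube_ideal d"
    moreover from I_uminus[OF this] have "g - f \<in> cube_ideal d" by simp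
    ultimately show "nil3_class d f = nil3_class d g" using sub by blast
  qed
qed

text \<open>
  Both conditions of a basis are pulled back along the quotient map: linear combinations of classes
  are classes of linear combinations, and the classes that vanish are those of elements of the ideal.
\<close>

lemma nil3_component_basis:
  fixes B :: "nat list set"
  assumes char: "CHAR('k::field) = 0 \<or> CHAR('k) > 3" and fin: "finite B"
    and words: "\<And>w. w \<in> B \<Longrightarrow> (word w :: nat list \<Rightarrow>\<^sub>0 'k) \<in> homogeneous d \<Delta>"
    and indep: "\<And>c :: nat list \<Rightarrow> 'k. (\<Sum>b\<in>B. Poly_Mapping.single b (c b)) \<in> cube_ideal d \<Longrightarrow> \<forall>b\<in>B. c b = 0"
    and span: "\<And>w. (word w :: nat list \<Rightarrow>\<^sub>0 'k) \<in> homogeneous d \<Delta> \<Longrightarrow> (word w :: nat list \<Rightarrow>\<^sub>0 'k) \<in> spanned d B"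
  shows "inj_on (word_class d :: nat list \<Rightarrow> (nat list \<Rightarrow>\<^sub>0 'k) set) B \<and>
    vectorspace.basis (class_ring :: 'k ring) (nil3_component d \<Delta>) (word_class d ` B)"
proof -
  let ?F = "free_alg d :: ('k, _) module" and ?N = "nil3_alg d :: ('k, _) module"
  let ?V = "nil3_component d \<Delta> :: ('k, _) module"
  let ?cls = "nil3_class d :: (nat list \<Rightarrow>\<^sub>0 'k) \<Rightarrow> _" and ?wc = "word_class d :: nat list \<Rightarrow> (nat list \<Rightarrow>\<^sub>0 'k) set"
  let ?H = "homogeneous d \<Delta> :: (nat list \<Rightarrow>\<^sub>0 'k) set"
  interpret nil3_ideal "carrier (free_alg d)" "cube_ideal d :: (nat list \<Rightarrow>\<^sub>0 'k) set"
    by (rule nil3_ideal_cube_ideal[OF char])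
  interpret V: vectorspace "class_ring :: 'k ring" ?V by (rule vectorspace_nil3_component)
  have hom: "?cls \<in> LinearCombinations.module_hom class_ring ?F ?N"
    using module_quot_alg(2)[OF module_free_alg submodule_cube_ideal, of d]
    by (simp add: nil3_class_def[abs_def] nil3_alg_def)
  have H_carrier: "f \<in> carrier ?F" if "f \<in> ?H" for f
    using that by (simp add: homogeneous_def)
  have cls_add: "?cls (f + g) = ?cls f \<oplus>\<^bsub>?V\<^esub> ?cls g" if "f \<in> ?H" "g \<in> ?H" for f g
    using LinearCombinations.module_hom_add[OF hom H_carrier[OF that(1)] H_carrier[OF that(2)]]
    by (simp add: nil3_component_def free_alg_simps)
  have cls_scale: "?cls (Poly_Mapping.map ((*) c) f) = c \<odot>\<^bsub>?V\<^esub> ?cls f" if "f \<in> ?H" for c f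
    using LinearCombinations.module_hom_smult[OF hom _ H_carrier[OF that], of c]
    by (simp add: nil3_component_def free_alg_simps)
  have cls_zero: "\<zero>\<^bsub>?V\<^esub> = ?cls 0"
  proof -
    have "?cls 0 = cube_ideal d"
      unfolding nil3_class_def a_r_coset_def' free_alg_simps by auto
    then show ?thesis by (simp add: nil3_component_def nil3_alg_def quot_alg_def)
  qed
  have carrier_V: "carrier ?V = ?cls ` ?H" by (simp add: nil3_component_def)
  have H_single: "Poly_Mapping.single b c \<in> ?H" if "b \<in> B" for b c
    using words[OF that] by (auto simp: homogeneous_def free_alg_simps split: if_splits)
  have H_zero: "0 \<in> ?H" by (simp add: homogeneous_def free_alg_simps)
  have H_add: "f + g \<in> ?H" if "f \<in> ?H" "g \<in> ?H" for f g
    using that Poly_Mapping.keys_add[of f g] by (fastforce simp: homogeneous_def free_alg_simps)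
  have H_sum: "(\<Sum>b\<in>S. f b) \<in> ?H" if "\<And>b. b \<in> S \<Longrightarrow> f b \<in> ?H" for S and f :: "nat list \<Rightarrow> _"
    using that by (induction S rule: infinite_finite_induct) (simp_all add: H_zero H_add)
  have inj: "inj_on ?wc B"
  proof (rule inj_onI, rule ccontr)
    fix u v assume uv: "u \<in> B" "v \<in> B" "?wc u = ?wc v" "u \<noteq> v"
    let ?c = "\<lambda>b. if b = u then 1 else if b = v then - 1 else (0::'k)"
    have "(\<Sum>b\<in>B. Poly_Mapping.single b (?c b)) = (\<Sum>b\<in>{u, v}. Poly_Mapping.single b (?c b))"
      using fin uv by (intro sum.mono_neutral_right) auto
    also have "\<dots> = word u - word v" using uv(4) by (simp add: single_uminus)
    also have "\<dots> \<in> cube_ideal d"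
      using uv(3) nil3_class_eq_iff[OF char] by (simp add: word_class_def)
    finally have "\<forall>b\<in>B. ?c b = 0" by (rule indep)
    from bspec[OF this uv(1)] show False by simp
  qed
  have lincomb: "V.lincomb a (?wc ` S) = ?cls (\<Sum>b\<in>S. Poly_Mapping.single b (a (?wc b)))" if "S \<subseteq> B" for S a
    using finite_subset[OF that fin] that
  proof (induction S rule: finite_induct)
    case empty
    then show ?case by (simp add: V.lincomb_def cls_zero)
  next
    case (insert v S)
    have S: "?wc ` S \<subseteq> carrier ?V" and v: "?wc v \<in> carrier ?V"
      using insert.prems words by (auto simp: carrier_V word_class_def)
    have "?wc v \<notin> ?wc ` S"
      using inj_on_image_mem_iff[OF inj, of v S] insert.hyps insert.prems by blast
    then have "V.lincomb a (?wc ` insert v S) = a (?wc v) \<odot>\<^bsub>?V\<^esub> ?wc v \<oplus>\<^bsub>?V\<^esub> V.lincomb a (?wc ` S)"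
      unfolding V.lincomb_def image_insert using insert.hyps S v
      by (intro V.finsum_insert) auto
    also have "a (?wc v) \<odot>\<^bsub>?V\<^esub> ?wc v = ?cls (Poly_Mapping.single v (a (?wc v)))"
      using cls_scale[OF words, of v "a (?wc v)"] insert.prems by (simp add: word_class_def)
    also have "V.lincomb a (?wc ` S) = ?cls (\<Sum>b\<in>S. Poly_Mapping.single b (a (?wc b)))"
      using insert.prems by (intro insert.IH) blast
    also have "?cls (Poly_Mapping.single v (a (?wc v))) \<oplus>\<^bsub>?V\<^esub> \<dots> =
        ?cls (Poly_Mapping.single v (a (?wc v)) + (\<Sum>b\<in>S. Poly_Mapping.single b (a (?wc b))))"
      using insert.prems by (intro cls_add[symmetric] H_single H_sum) blast+
    finally show ?case
      by (simp only: sum.insert[OF insert.hyps])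
  qed
  have "V.lin_indpt (?wc ` B)"
  proof (rule V.finite_lin_indpt2)
    show "finite (?wc ` B)" using fin by simp
    show "?wc ` B \<subseteq> carrier ?V" using words by (auto simp: carrier_V word_class_def)
    fix a assume "V.lincomb a (?wc ` B) = \<zero>\<^bsub>?V\<^esub>"
    then have "?cls (\<Sum>b\<in>B. Poly_Mapping.single b (a (?wc b))) = ?cls 0"
      unfolding lincomb[OF subset_refl] cls_zero .
    then have "(\<Sum>b\<in>B. Poly_Mapping.single b (a (?wc b))) \<in> cube_ideal d"
      unfolding nil3_class_eq_iff[OF char] diff_zero .
    from indep[OF this] show "\<forall>v\<in>?wc ` B. a v = \<zero>\<^bsub>class_ring\<^esub>" by simp
  qed
  moreover have "V.gen_set (?wc ` B)"
  proof
    have sub: "?wc ` B \<subseteq> carrier ?V" using words by (auto simp: carrier_V word_class_def)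
    then show "V.span (?wc ` B) \<subseteq> carrier ?V" by (rule V.span_is_subset2)
    show "carrier ?V \<subseteq> V.span (?wc ` B)"
    proof
      fix X assume "X \<in> carrier ?V"
      then obtain f where f: "f \<in> ?H" "X = ?cls f" by (auto simp: carrier_V)
      have "f = (\<Sum>w\<in>Poly_Mapping.keys f. Poly_Mapping.single w (Poly_Mapping.lookup f w))"
        by (simp add: sum_of_monomials)
      also have "\<dots> \<in> spanned d B"
      proof (rule spanned_sum[OF char fin])
        fix w assume "w \<in> Poly_Mapping.keys f"
        then have "word w \<in> ?H" using f(1) by (simp add: homogeneous_def free_alg_simps)
        from single_spanned[OF char fin span[OF this]]
        show "Poly_Mapping.single w (Poly_Mapping.lookup f w) \<in> spanned d B" .
      qed
      finally obtain c where c: "f - (\<Sum>b\<in>B. Poly_Mapping.single b (c b)) \<in> cube_ideal d"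
        unfolding spanned_def by blast
      let ?a = "\<lambda>v. c (inv_into B ?wc v)"
      have "X = ?cls (\<Sum>b\<in>B. Poly_Mapping.single b (c b))"
        unfolding f(2) nil3_class_eq_iff[OF char] by (rule c)
      also have "(\<Sum>b\<in>B. Poly_Mapping.single b (c b)) = (\<Sum>b\<in>B. Poly_Mapping.single b (?a (?wc b)))"
        by (intro sum.cong) (simp_all add: inv_into_f_f[OF inj])
      also have "?cls \<dots> = V.lincomb ?a (?wc ` B)" by (rule lincomb[OF subset_refl, symmetric])
      finally have "X = V.lincomb ?a (?wc ` B)" .
      moreover have "finite (?wc ` B)" using fin by (rule finite_imageI)
      ultimately show "X \<in> V.span (?wc ` B)"
        unfolding V.span_def by auto
    qed
  qed
  ultimately show ?thesis
    using inj words unfolding V.basis_def by (auto simp: carrier_V word_class_def)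
qed

text \<open>
  The sorted word of multidegree \<open>\<Delta>\<close>; all other words of this multidegree are its arrangements.
\<close>

definition letters :: "nat list \<Rightarrow> nat list" where
  "letters \<Delta> = concat (map (\<lambda>i. replicate (\<Delta> ! i) (i + 1)) [0..<length \<Delta>])"

definition has_multidegree :: "nat list \<Rightarrow> nat list \<Rightarrow> bool" where
  "has_multidegree \<Delta> w \<longleftrightarrow> w \<noteq> [] \<and> list_all (\<lambda>i. 1 \<le> i \<and> i \<le> length \<Delta>) w \<and>
     list_all (\<lambda>i. count_list w (i + 1) = \<Delta> ! i) [0..<length \<Delta>]"

definition certified :: "nat list \<Rightarrow> dual_system \<Rightarrow> derivation \<Rightarrow> bool" where
  "certified \<Delta> ds sts \<longleftrightarrow> basis_words \<Delta> = set (map fst ds) \<and> list_all (has_multidegree \<Delta>) (map fst ds) \<and> triangular ds \<and>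
     covers (fold (resolve (length \<Delta>)) sts (map fst ds)) (arrangements (letters \<Delta>))"

lemma word_homogeneous_iff:
  "(word w :: nat list \<Rightarrow>\<^sub>0 'k::field) \<in> homogeneous (length \<Delta>) \<Delta> \<longleftrightarrow> has_multidegree \<Delta> w"
  by (auto simp: homogeneous_def free_alg_simps has_multidegree_def list_all_iff subset_iff)

lemma count_letters: "count_list (letters \<Delta>) x = (if x \<in> {1..length \<Delta>} then \<Delta> ! (x - 1) else 0)"
proof -
  have "count_list (concat (map (\<lambda>i. replicate (\<Delta> ! i) (i + 1)) [0..<n])) x =
      (if x \<in> {1..n} then \<Delta> ! (x - 1) else 0)" for n
  proof (induction n)
    case (Suc n)
    have "count_list (replicate k y) x = (if x = y then k else 0)" for k y :: nat
      by (induction k) auto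
    then show ?case using Suc by auto
  qed simp
  then show ?thesis by (simp add: letters_def)
qed

lemma has_multidegree_mset: "has_multidegree \<Delta> w \<Longrightarrow> mset w = mset (letters \<Delta>)"
proof (rule multiset_eqI)
  fix x assume w: "has_multidegree \<Delta> w"
  show "count (mset w) x = count (mset (letters \<Delta>)) x"
  proof (cases "x \<in> {1..length \<Delta>}")
    case True
    then obtain i where i: "x = i + 1" "i < length \<Delta>" by (cases x) auto
    then have "count_list w x = \<Delta> ! i"
      using w by (simp add: has_multidegree_def list_all_iff)
    then show ?thesis using i by (simp add: count_mset count_letters)
  next
    case False
    then have "x \<notin> set w" using w by (auto simp: has_multidegree_def list_all_iff)
    then show ?thesis using False by (auto simp: count_mset count_letters count_list_0_iff)
  qed
qed

lemma length_letters: "length (letters \<Delta>) = sum_list \<Delta>"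
proof -
  have "map (\<lambda>i. \<Delta> ! i) [0..<length \<Delta>] = \<Delta>" by (rule map_nth)
  then show ?thesis
    by (simp add: letters_def length_concat comp_def)
qed

lemma certified_basis:
  assumes char: "CHAR('k::field) = 0 \<or> CHAR('k) > 3" and cert: "certified \<Delta> ds sts"
  shows "inj_on (word_class (length \<Delta>) :: nat list \<Rightarrow> (nat list \<Rightarrow>\<^sub>0 'k) set) (basis_words \<Delta>) \<and>
    vectorspace.basis (class_ring :: 'k ring) (nil3_component (length \<Delta>) \<Delta>)
      (word_class (length \<Delta>) ` basis_words \<Delta>)"
proof (rule nil3_component_basis[OF char])
  let ?B = "basis_words \<Delta>"
  have B: "?B = set (map fst ds)" using cert by (simp add: certified_def)
  show "finite ?B" by (simp add: B)
  show "(word w :: nat list \<Rightarrow>\<^sub>0 'k) \<in> homogeneous (length \<Delta>) \<Delta>" if "w \<in> ?B" for w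
    unfolding word_homogeneous_iff using that cert by (auto simp: B certified_def list_all_iff)
  show "\<forall>b\<in>?B. c b = 0" if "(\<Sum>b\<in>?B. Poly_Mapping.single b (c b)) \<in> cube_ideal (length \<Delta>)" for c :: "nat list \<Rightarrow> 'k"
    using triangular_independent[OF char, of ds c "length \<Delta>"] cert that unfolding B certified_def by blast
  show "(word w :: nat list \<Rightarrow>\<^sub>0 'k) \<in> spanned (length \<Delta>) ?B" if "(word w :: nat list \<Rightarrow>\<^sub>0 'k) \<in> homogeneous (length \<Delta>) \<Delta>" for w
    using covers_spanned[OF char, of "length \<Delta>" sts "map fst ds" "letters \<Delta>" w] cert
      has_multidegree_mset[of \<Delta> w] that
    unfolding B certified_def word_homogeneous_iff by blast
qed

text \<open>
  All words of length at least six lie in the ideal, so the component is zero.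
\<close>

lemma high_degree_basis:
  assumes char: "CHAR('k::field) = 0 \<or> CHAR('k) > 3" and deg: "sum_list \<Delta> \<ge> 6"
  shows "inj_on (word_class (length \<Delta>) :: nat list \<Rightarrow> (nat list \<Rightarrow>\<^sub>0 'k) set) {} \<and>
    vectorspace.basis (class_ring :: 'k ring) (nil3_component (length \<Delta>) \<Delta>) (word_class (length \<Delta>) ` {})"
proof (rule nil3_component_basis[OF char])
  show "(word w :: nat list \<Rightarrow>\<^sub>0 'k) \<in> spanned (length \<Delta>) {}" if "(word w :: nat list \<Rightarrow>\<^sub>0 'k) \<in> homogeneous (length \<Delta>) \<Delta>" for w
  proof (rule spanned_cube_ideal[OF char finite.emptyI], rule long_word_in_cube_ideal[OF char])
    have w: "has_multidegree \<Delta> w" using that by (simp only: word_homogeneous_iff)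
    have "length w = sum_list \<Delta>"
      using arg_cong[OF has_multidegree_mset[OF w], of size] by (simp add: length_letters)
    then show "6 \<le> length w" using deg by simp
    show "set w \<subseteq> {1..length \<Delta>}" using w by (auto simp: has_multidegree_def list_all_iff)
  qed
qed simp_all

lemma partitions_up_to_5:
  assumes "sorted_wrt (\<ge>) \<Delta>" "\<forall>\<delta>\<in>set \<Delta>. \<delta> \<ge> 1" "sum_list \<Delta> \<le> 5" "\<Delta> \<noteq> []"
  shows "\<Delta> \<in> {[1::nat], [1, 1], [2], [1, 1, 1], [2, 1], [3], [1, 1, 1, 1], [2, 1, 1], [2, 2], [3, 1], [4],
    [1, 1, 1, 1, 1], [2, 1, 1, 1], [2, 2, 1], [3, 1, 1], [3, 2], [4, 1], [5]}"
proof -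
  have "length \<Delta> \<le> sum_list \<Delta>"
    using assms(2) by (induction \<Delta>) auto
  then have "length \<Delta> \<le> 5" using assms(3) by simp
  then consider a where "\<Delta> = [a]" | a b where "\<Delta> = [a, b]" | a b c where "\<Delta> = [a, b, c]"
    | a b c d where "\<Delta> = [a, b, c, d]" | a b c d e where "\<Delta> = [a, b, c, d, e]"
    using assms(4) by (auto simp: le_Suc_eq length_Suc_conv numeral_eq_Suc)
  then show ?thesis
  proof cases
    case 1
    then have "a \<in> {1, 2, 3, 4, 5}" using assms by auto
    then show ?thesis using 1 by auto
  next
    case (2 a b)
    then have "a \<in> {1, 2, 3, 4}" "b \<in> {1, 2}" using assms by auto
    then show ?thesis using 2 assms by auto
  next
    case (3 a b c)
    then have "a \<in> {1, 2, 3}" "b \<in> {1, 2}" "c = 1" using assms by auto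
    then show ?thesis using 3 assms by auto
  next
    case (4 a b c d)
    then have "a \<in> {1, 2}" "b = 1" "c = 1" "d = 1" using assms by auto
    then show ?thesis using 4 assms by auto
  next
    case (5 a b c d e)
    then have "a = 1" "b = 1" "c = 1" "d = 1" "e = 1" using assms by auto
    then show ?thesis using 5 assms by auto
  qed
qed

section \<open>Certificates for degrees at most five\<close>

text \<open>
  The words are ordered such that the forms have a triangular matrix.  The letter $0$ pads words of
  length less than five.  The single letter $1$ needs four different padding letters because the
  component of multidegree $41$ is zero, so that every form vanishes on a word with four equal
  letters and one other letter.
\<close>

definition dual_1 :: dual_system where
  "dual_1 =
    [([1], [(1, [], [0,6,7,8], (6,7,0,8,1))])]"

definition dual_11 :: dual_system where
  "dual_11 =
    [([1,2], [(1, [0], [0,0], (0,0,0,1,2))]), ([2,1], [(1, [0], [0,0], (0,2,0,0,1))])]"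

definition dual_2 :: dual_system where
  "dual_2 =
    [([1,1], [(1, [0], [0,0], (0,1,0,0,1))])]"

definition dual_111 :: dual_system where
  "dual_111 =
    [([1,3,2], [(1, [0], [0], (0,1,0,3,2))]), ([1,2,3], [(1, [0,0], [], (0,3,0,1,2))]),
     ([2,1,3], [(1, [], [0,0], (0,2,0,1,3))]), ([2,3,1], [(1, [], [0,0], (1,3,0,0,2))]),
     ([3,1,2], [(1, [], [0,0], (2,3,0,0,1))])]"

definition dual_21 :: dual_system where
  "dual_21 =
    [([1,1,2], [(1, [0], [0], (0,1,0,1,2))]), ([2,1,1], [(1, [0], [0], (1,2,0,0,1))])]"

definition dual_211 :: dual_system where
  "dual_211 =
    [([1,1,2,3], [(1, [], [0], (1,3,0,1,2))]), ([2,3,1,1], [(1, [], [0], (0,1,1,2,3))]),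
     ([3,2,1,1], [(1, [], [0], (0,2,1,1,3))]), ([2,1,1,3], [(1, [0], [], (1,2,0,1,3))]),
     ([1,1,3,2], [(1, [], [0], (2,3,0,1,1))])]"

definition dual_22 :: dual_system where
  "dual_22 =
    [([1,1,2,2], [(1, [], [0], (2,2,0,1,1))]), ([2,2,1,1], [(1, [], [0], (0,1,1,2,2))])]"

definition dual_31 :: dual_system where
  "dual_31 =
    [([1,1,2,1], [(1, [], [0], (1,2,0,1,1))])]"

definition dual_221 :: dual_system where
  "dual_221 =
    [([1,1,2,2,3], [(1, [], [], (2,2,1,1,3))]), ([3,1,1,2,2], [(1, [], [], (1,2,1,2,3))]),
     ([2,2,1,1,3], [(1, [], [], (1,3,1,2,2))])]"

definition dual_311 :: dual_system where
  "dual_311 =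
    [([1,1,2,3,1], [(1, [], [], (1,1,1,2,3))]), ([1,1,3,2,1], [(1, [], [], (2,3,1,1,1))])]"

definition dual_32 :: dual_system where
  "dual_32 =
    [([1,1,2,2,1], [(1, [], [], (2,2,1,1,1))])]"

definition dual_1111 :: dual_system where
  "dual_1111 =
    [([2,3,4,1], [(1, [], [0], (0,2,1,3,4)), (1, [], [0], (0,3,1,2,4))]),
     ([1,2,3,4], [(1, [], [0], (3,4,0,1,2)), (- 1, [], [0], (0,2,1,4,3)), (- 1, [0], [], (1,3,0,4,2))]),
     ([1,3,2,4], [(1, [], [0], (0,2,1,3,4))]),
     ([1,2,4,3], [(1, [], [0], (3,4,0,1,2)), (- 1, [0], [], (2,3,0,1,4)), (- 1, [0], [], (1,2,0,4,3)), (1, [], [0], (2,4,0,3,1))]),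
     ([2,1,4,3], [(1, [0], [], (1,2,0,4,3))]), ([2,1,3,4], [(1, [], [0], (3,4,0,2,1))]),
     ([2,3,1,4], [(1, [], [0], (1,3,0,2,4)), (1, [0], [], (3,4,0,2,1))]),
     ([2,4,1,3], [(1, [], [0], (1,3,0,2,4))]), ([1,3,4,2], [(1, [0], [], (2,3,0,1,4))]),
     ([3,1,2,4], [(1, [], [0], (3,4,0,1,2))]), ([1,4,2,3], [(1, [], [0], (2,3,0,1,4))]),
     ([3,4,1,2], [(1, [], [0], (0,4,1,2,3))])]"

definition dual_11111 :: dual_system where
  "dual_11111 =
    [([2,3,5,1,4], [(1, [], [], (3,4,1,2,5)), (1, [], [], (2,3,1,4,5)), (1, [], [], (2,4,1,3,5))]),
     ([2,3,4,1,5], [(1, [], [], (2,5,1,3,4)), (1, [], [], (3,5,1,2,4)), (1, [], [], (2,3,1,5,4))]),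
     ([1,3,4,5,2], [(1, [], [], (1,3,2,4,5)), (1, [], [], (1,4,2,3,5))]),
     ([2,3,1,4,5], [(1, [], [], (2,5,1,4,3)), (1, [], [], (4,5,1,2,3)), (1, [], [], (2,4,1,5,3))]),
     ([1,2,4,3,5], [(1, [], [], (1,3,2,5,4)), (1, [], [], (1,5,2,3,4)), (- 1, [], [], (2,5,1,4,3))]),
     ([1,2,3,4,5], [(1, [], [], (1,3,2,4,5))]),
     ([1,3,2,5,4], [(1, [], [], (3,4,1,2,5)), (- 1, [], [], (2,3,1,5,4)), (- 1, [], [], (1,5,2,4,3)), (- 1, [], [], (4,5,1,3,2))]),
     ([1,2,3,5,4], [(1, [], [], (2,3,1,5,4))]),
     ([1,3,2,4,5], [(1, [], [], (3,4,1,2,5)), (1, [], [], (1,4,2,5,3))]),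
     ([1,4,5,2,3], [(1, [], [], (1,2,3,4,5)), (1, [], [], (3,5,1,4,2))]),
     ([1,2,5,3,4], [(1, [], [], (1,5,2,3,4))]), ([1,3,5,2,4], [(1, [], [], (2,5,1,3,4))]),
     ([1,4,2,3,5], [(1, [], [], (1,3,2,5,4))]), ([1,2,4,5,3], [(1, [], [], (2,3,1,4,5))]),
     ([1,3,4,2,5], [(1, [], [], (3,4,1,2,5))])]"

definition dual_2111 :: dual_system where
  "dual_2111 =
    [([1,1,2,3,4], [(1, [], [], (2,3,1,1,4)), (1, [], [], (1,2,1,3,4))]),
     ([2,3,1,1,4], [(1, [], [], (1,4,1,2,3))]), ([2,4,1,1,3], [(1, [], [], (1,3,1,2,4))]),
     ([2,1,1,3,4], [(1, [], [], (1,1,2,3,4))]), ([1,1,3,2,4], [(1, [], [], (2,3,1,1,4))]),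
     ([2,1,1,4,3], [(1, [], [], (1,4,1,3,2))]), ([1,1,4,2,3], [(1, [], [], (2,4,1,1,3))])]"
text \<open>
  Each step yields a single new word; the order of the steps matters.  In \<open>derivation_11111\<close>, when the
  single relations and \<open>quartic\<close> lead no further, the words that are missing in a combination of fourteen
  relations cancel except for $31542$, which is left with coefficient $6$.
\<close>

definition derivation_111 :: derivation where
  "derivation_111 =
    map once [Cube [] [1] [2] [3] []]"

definition derivation_21 :: derivation where
  "derivation_21 =
    map once [Cube [] [1] [1] [2] []]"

definition derivation_211 :: derivation where
  "derivation_211 =
    map once [Cube [] [1] [1] [2] [3], Cube [] [1] [1] [2,3] [], Cube [] [1,1] [2] [3] [],
     Cube [] [1] [1] [3] [2], Cube [] [1] [1,2] [3] [], Cube [1] [1] [2] [3] [],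
     Cube [] [1] [1,3] [2] []]"

definition derivation_22 :: derivation where
  "derivation_22 =
    map once [Cube [] [1] [1] [2,2] [], Cube [] [1,1] [2] [2] [], Cube [] [1] [1] [2] [2],
     Cube [] [1] [1,2] [2] []]"

definition derivation_31 :: derivation where
  "derivation_31 =
    map once [Cube [] [1] [1] [1] [2], Cube [] [1] [1] [1,2] [], Cube [] [1] [1,1] [2] []]"

definition derivation_221 :: derivation where
  "derivation_221 =
    map once [Cube [] [1] [1] [2,2] [3], Cube [] [1,1] [2] [2] [3], Cube [] [1] [1] [2] [2,3],
     Cube [] [1] [1,2] [2] [3], Anti [1] [1] [2] [2] [3], Cube [] [1,2] [1,2] [3] [],
     Cube [3] [1] [1] [2] [2], Cube [3] [1,1] [2] [2] [], Cube [3] [1] [1] [2,2] [],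
     Cube [3] [1] [1,2] [2] [], Cube [] [2,1] [2,1] [3] [], Anti [1] [2] [2] [3] [1],
     Cube [] [1] [1] [2,2,3] [], Cube [] [1] [1,2,2] [3] [], Cube [] [1,1] [2,2] [3] [],
     Cube [1] [1] [2,2] [3] [], Cube [1,1] [2] [2] [3] [], Cube [] [1,1,2] [2] [3] [],
     Cube [] [1] [1,2] [2,3] [], Cube [] [1,1] [2] [2,3] [], Cube [1] [1] [2] [2,3] [],
     Cube [1] [1,2] [2] [3] [], Cube [] [1] [1,2] [3] [2], Cube [] [1] [1] [2] [3,2],
     Cube [] [1] [1,2,3] [2] [], Cube [] [1] [1,3] [2] [2], Cube [] [1] [1,3] [2,2] []]"

definition derivation_311 :: derivation where
  "derivation_311 =
    map once [Cube [] [1] [1] [1] [2,3], Cube [] [1] [1] [1,2,3] [], Cube [] [1] [1,1] [2,3] [],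
     Cube [] [1] [1] [1] [3,2], Cube [] [1] [1] [1,3,2] [], Cube [] [1] [1,1] [3,2] [],
     Cube [2] [1] [1] [1] [3], Cube [] [1,1,1] [2] [3] [], Odd [1] [1] [1] [2] [3],
     Cube [] [1,1] [2] [3] [1], Cube [] [1] [1] [2] [3,1], Cube [] [1] [1,2] [3,1] [],
     Cube [] [1] [1,1,2] [3] [], Cube [] [1] [1] [1,2] [3], Cube [1,1] [1] [2] [3] [],
     Cube [] [1,1] [1,2] [3] [], Cube [1] [1] [1,2] [3] [], Cube [] [1,1] [1,3] [2] []]"

definition derivation_32 :: derivation where
  "derivation_32 =
    map once [Cube [] [1] [1] [1] [2,2], Cube [] [1] [1] [1,2,2] [], Cube [] [1] [1,1] [2,2] [],
     Cube [] [1,1,1] [2] [2] [], Cube [1] [1,1] [2] [2] [], Cube [] [1] [1] [1,2] [2],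
     Cube [] [1] [1,1,2] [2] [], Cube [] [1,1] [1,2] [2] [], Cube [1] [1] [1,2] [2] []]"

definition derivation_1111 :: derivation where
  "derivation_1111 =
    map once [Cube [] [1] [2] [3] [4], Cube [] [1] [2] [3,4] [], Cube [1] [2] [3] [4] [],
     Cube [] [1,4] [2] [3] [], Cube [2] [1] [3] [4] [], Cube [] [1] [2,4] [3] []]
    @ [quartic [] [1] [2] [3] [4] []]
    @ map once [Cube [] [1] [3,2] [4] [], Cube [] [1] [2] [4,3] [], Cube [] [1,2] [3] [4] [],
     Cube [] [1] [2,3] [4] [], Cube [] [1] [2] [4] [3]]"

definition derivation_11111 :: derivation where
  "derivation_11111 =
    map once [Cube [1] [2] [3] [4] [5], Cube [1] [2] [3] [4,5] [], Cube [1,2] [3] [4] [5] [],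
     Cube [1] [2,5] [3] [4] [], Cube [1,3] [2] [4] [5] [], Cube [1] [2] [3,5] [4] []]
    @ [quartic [1] [2] [3] [4] [5] []]
    @ map once [Cube [1] [2] [4,3] [5] [], Cube [1] [2] [3] [5,4] [], Cube [1] [2,3] [4] [5] [],
     Cube [1] [2] [3,4] [5] [], Cube [1] [2] [3] [5] [4], Odd [1] [3] [5] [4] [2],
     Anti [5] [2] [3] [4] [1], Odd [1] [2] [5] [4] [3]]
    @ [[(- 2, Cube [] [1,4,5] [2] [3] []), (- 2, Cube [] [1,5] [2,4] [3] []),
     (2, Cube [] [1] [3] [5,2,4] []), (2, Cube [] [1] [3] [5,4,2] []),
     (- 2, Anti [5] [2] [4] [1] [3]), (- 2, Anti [5] [2] [4] [3] [1]),
     (2, Anti [1] [4] [5] [2] [3]), (2, Anti [2] [1] [4] [5] [3]), (1, Cube [] [3,1,5] [4] [2] []),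
     (- 1, Cube [] [3,1] [5,2] [4] []), (- 1, Cube [] [1,5] [4] [2,3] []),
     (1, Cube [] [1] [5,2,3] [4] []), (1, Anti [1] [5] [4] [2] [3]), (1, Anti [2] [3] [4] [1] [5])]]
    @ map once [Anti [1] [4] [5] [2] [3], Cube [] [1,4,5] [2] [3] [], Anti [1] [4] [5] [3] [2],
     Anti [3] [1] [4] [5] [2], Odd [1] [4] [2] [5] [3], Anti [2] [3] [4] [5] [1],
     Cube [] [1] [2,3,4] [5] [], Anti [1] [2] [3] [4] [5], Odd [1] [3] [2] [5] [4],
     Cube [] [1] [3] [4] [5,2], Cube [] [1,5] [3] [4] [2], Odd [2] [1] [4] [3] [5],
     Cube [] [1,4] [2] [3] [5], Anti [1] [2] [4] [5] [3], Cube [] [1] [2] [3] [4,5],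
     Odd [2] [1] [3] [4] [5], Anti [1] [2] [4] [3] [5], Cube [] [1,4] [2,3] [5] [],
     Cube [] [1] [2,3] [5] [4], Cube [] [1,5,4] [2] [3] [], Cube [2,3] [1] [4] [5] [],
     Anti [2] [1] [3] [4] [5], Cube [] [1] [3,4] [5,2] [], Cube [] [1] [2] [3,4,5] [],
     Cube [3] [1] [2] [4,5] [], Cube [] [1] [3,2,4] [5] [], Cube [] [1,5] [3,2] [4] [],
     Cube [] [1] [3,2] [4] [5], Cube [] [1,5] [2] [4,3] [], Cube [] [1] [2] [4,3] [5],
     Cube [] [1] [2,4] [3] [5], Cube [] [1] [2,4,3] [5] [], Cube [] [1,3] [2] [4] [5],
     Cube [] [1] [2] [4] [3,5], Cube [] [1] [2,3] [4] [5], Cube [] [1,2] [3] [4] [5],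
     Cube [] [1] [2] [3,4] [5], Cube [] [1,2] [3,4] [5] [], Cube [] [1] [2,3,5] [4] [],
     Cube [] [1] [3,4] [5] [2], Cube [] [1,3,4] [2] [5] [], Cube [] [1] [2] [5] [3,4],
     Cube [] [1,3] [2] [5] [4], Cube [] [1] [2] [3] [5,4], Cube [] [1,2,5] [3] [4] [],
     Cube [] [1] [4,2,3] [5] [], Cube [] [1] [2,3] [5,4] [], Cube [] [1,2,3] [4] [5] [],
     Cube [] [1] [2,3] [4,5] [], Cube [] [1,2] [3] [4,5] [], Cube [] [1,2] [4] [5,3] [],
     Cube [] [1,2] [3] [5] [4], Cube [] [1] [2] [3,5] [4], Cube [] [1] [2,4] [3,5] [],
     Cube [] [1] [3] [4,5] [2], Cube [] [1] [3,2] [4,5] [], Cube [] [1] [2] [4,5,3] [],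
     Cube [] [1] [2,4] [5,3] [], Cube [] [1] [2] [4] [5,3], Cube [] [1] [2,4,5] [3] [],
     Cube [] [1] [2] [4,5] [3], Cube [] [1] [2,4] [5] [3], Cube [] [1,3,2] [4] [5] [],
     Cube [] [1] [3] [5] [2,4], Cube [] [1] [3,5,2] [4] [], Cube [] [1] [2] [4,3,5] [],
     Cube [] [1,2] [3,5] [4] [], Cube [] [1] [2] [3,5,4] [], Cube [] [1,2] [3] [5,4] [],
     Cube [] [1] [3] [5,4,2] [], Cube [] [1] [2] [5,4] [3], Cube [] [1,3] [2,5] [4] [],
     Cube [] [1] [2,5] [4] [3], Cube [] [1] [2] [5] [4,3], Cube [] [1] [3,5] [4] [2],
     Cube [] [1] [3] [5] [4,2], Cube [] [1,4,3] [2] [5] [], Cube [] [1] [4] [5] [2,3],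
     Cube [] [1] [4] [5,3,2] [], Cube [] [1] [2] [5,3] [4], Cube [] [1] [2,5] [3] [4],
     Cube [] [2,1] [3,4] [5] [], Cube [] [1] [2] [5,3,4] [], Cube [] [1] [2,5] [3,4] [],
     Cube [] [1] [2,5,3] [4] [], Cube [] [2,1] [3] [5,4] [], Cube [] [1] [2] [5,4,3] [],
     Cube [] [1] [2,5] [4,3] [], Cube [] [1] [2,5,4] [3] []]"

definition derivation_2111 :: derivation where
  "derivation_2111 =
    map once [Cube [] [1] [1] [2] [3,4], Cube [] [1] [1] [2,3] [4], Cube [2] [1] [1] [3] [4],
     Cube [2] [1] [1] [4] [3], Anti [2] [1] [1] [3] [4], Cube [] [1] [1] [4,2] [3],
     Anti [2] [1] [1] [4] [3], Cube [] [1,1] [2] [3] [4], Cube [] [1] [1] [3] [2,4],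
     Cube [] [1] [1,2] [3] [4], Cube [1] [1] [2] [3] [4], Anti [3] [1] [1] [2] [4],
     Anti [3] [1] [1] [4] [2], Cube [] [1,1,4] [2] [3] [], Cube [] [1] [1] [4,3] [2],
     Anti [1] [1] [4] [3] [2], Cube [] [1] [1] [4] [3,2], Cube [] [1,1,3] [2] [4] [],
     Cube [1,1] [2] [3] [4] [], Cube [] [1] [1] [2] [4,3], Cube [] [1] [1] [2,4] [3],
     Cube [] [1,1] [2] [4] [3], Cube [] [1,1,2] [3] [4] [], Cube [1] [1] [2] [4] [3],
     Cube [1] [1,2] [3] [4] [], Cube [] [1] [1,2] [4] [3], Cube [] [1] [1] [3] [4,2],
     Cube [] [1] [1,3] [4] [2], Cube [] [1] [1,4] [3] [2]]
    @ [quartic [] [1] [1,2] [3] [4] []]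
    @ map once [Cube [] [1] [1] [2,3,4] [], Cube [] [1] [1,2] [3,4] [], Cube [] [1] [1,2,3] [4] [],
     Cube [] [1,1] [2] [3,4] [], Cube [] [1,1] [2,3] [4] [], Cube [1] [1] [2] [3,4] [],
     Cube [1] [1] [2,3] [4] [], Cube [] [1] [1,3] [4,2] [], Cube [] [1] [1,3,4] [2] [],
     Cube [] [1] [1,4] [2,3] [], Cube [] [1] [1,4,2] [3] [], Cube [] [1,2,1] [3] [4] [],
     Cube [] [1] [1,2] [4,3] [], Cube [] [1] [1] [2,4,3] [], Cube [] [1] [1,2,4] [3] [],
     Cube [] [1,1] [2] [4,3] [], Cube [] [1,1] [2,4] [3] [], Cube [1] [1] [2] [4,3] [],
     Cube [1] [1] [2,4] [3] [], Cube [] [1] [1,3] [2,4] [], Cube [] [1] [1,3,2] [4] [],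
     Cube [] [1] [1,4] [3,2] [], Cube [] [1] [1,4,3] [2] []]"

definition derivation_3 :: derivation where
  "derivation_3 =
    map once [Cube [] [1] [1] [1] []]"

definition derivation_4 :: derivation where
  "derivation_4 =
    map once [Cube [] [1] [1] [1] [1]]"

definition derivation_5 :: derivation where
  "derivation_5 =
    map once [Cube [] [1] [1] [1] [1,1]]"

definition derivation_41 :: derivation where
  "derivation_41 =
    map once [Cube [] [1] [1] [1] [1,2], Cube [] [1] [1] [1] [2,1], Cube [] [1] [1] [1,1,2] [],
     Cube [] [1] [1,1] [1,2] [], Cube [] [1] [1,1,1] [2] []]"

lemma certified_1: "certified [1] dual_1 []"
  by code_simp

lemma certified_11: "certified [1, 1] dual_11 []"
  by code_simp

lemma certified_2: "certified [2] dual_2 []"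
  by code_simp

lemma certified_111: "certified [1, 1, 1] dual_111 derivation_111"
  by code_simp

lemma certified_21: "certified [2, 1] dual_21 derivation_21"
  by code_simp

lemma certified_3: "certified [3] [] derivation_3"
  by code_simp

lemma certified_1111: "certified [1, 1, 1, 1] dual_1111 derivation_1111"
  by code_simp

lemma certified_211: "certified [2, 1, 1] dual_211 derivation_211"
  by code_simp

lemma certified_22: "certified [2, 2] dual_22 derivation_22"
  by code_simp

lemma certified_31: "certified [3, 1] dual_31 derivation_31"
  by code_simp

lemma certified_4: "certified [4] [] derivation_4"
  by code_simp

lemma certified_11111: "certified [1, 1, 1, 1, 1] dual_11111 derivation_11111"
  by code_simp

lemma certified_2111: "certified [2, 1, 1, 1] dual_2111 derivation_2111"
  by code_simp

lemma certified_221: "certified [2, 2, 1] dual_221 derivation_221"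
  by code_simp

lemma certified_311: "certified [3, 1, 1] dual_311 derivation_311"
  by code_simp

lemma certified_32: "certified [3, 2] dual_32 derivation_32"
  by code_simp

lemma certified_41: "certified [4, 1] [] derivation_41"
  by code_simp

lemma certified_5: "certified [5] [] derivation_5"
  by code_simp

lemma ex_certificate:
  assumes "sorted_wrt (\<ge>) \<Delta>" "\<forall>\<delta>\<in>set \<Delta>. \<delta> \<ge> 1" "sum_list \<Delta> \<le> 5" "\<Delta> \<noteq> []"
  shows "\<exists>ds sts. certified \<Delta> ds sts"
  using partitions_up_to_5[OF assms]
  by (elim insertE emptyE; hypsubst; intro exI)
    (rule certified_1 certified_11 certified_2 certified_111 certified_21
      certified_3 certified_1111 certified_211 certified_22 certified_31
      certified_4 certified_11111 certified_2111 certified_221 certified_311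
      certified_32 certified_41 certified_5)+

theorem proposition2:
  fixes d :: nat and \<Delta> :: "nat list"
  assumes "infinite (UNIV :: 'k::field set)"
    and "CHAR('k) = 0 \<or> CHAR('k) > 3"
    and "d \<ge> 1"
    and "length \<Delta> = d"
    and "sorted_wrt (\<ge>) \<Delta>"
    and "\<forall>\<delta>\<in>set \<Delta>. \<delta> \<ge> 1"
  shows "inj_on (word_class d :: nat list \<Rightarrow> (nat list \<Rightarrow>\<^sub>0 'k) set) (basis_words \<Delta>) \<and>
    vectorspace.basis (class_ring :: 'k ring) (nil3_component d \<Delta>)
      (word_class d ` basis_words \<Delta>)"
proof (cases "sum_list \<Delta> \<ge> 6")
  case True
  then have "basis_words \<Delta> = {}" by (auto simp: basis_words_def)
  then show ?thesis using high_degree_basis[OF assms(2) True] assms(4) by simp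
next
  case False
  have "\<Delta> \<noteq> []" using assms(3,4) by auto
  then obtain ds sts where "certified \<Delta> ds sts"
    using ex_certificate[OF assms(5,6)] False by auto
  from certified_basis[OF assms(2) this] show ?thesis by (simp only: assms(4))
qed

end
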